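(* Let $\nu$ be a tail measure with index $\alpha>0$ on $(\mathrm D,\mathscr D)$, with weights $p_h=\nu(\{f\in \mathrm D:\|f\|_h>1\})$, local tail processes $Y^{[h]}$ and local spectral tail processes $\Theta^{[h]}$, $h\in\mathcal Q$. Then: (a) For all $h\in\mathcal Q$, $\mathbb P\{\|Y^{[h]}\|_h>1\}=\mathbb P\{\|\Theta^{[h]}\|_h=1\}=1$. If $p_h=0$ and $p_t>0$, $h,t\in\mathcal Q$, then $\|Y^{[t]}\|_h=\|\Theta^{[t]}\|_h=0$ almost surely. (b) For all $h,t\in\mathcal Q$ with $p_hp_t>0$, $$p_h\,\mathbb E\{\|\Theta^{[h]}\|_t^{\alpha}\,\Gamma(\Theta^{[h]})\}=p_t\,\mathbb E\{\mathbf 1(\|\Theta^{[t]}\|_h\neq 0)\,\Gamma(\Theta^{[t]})\},\qquad\forall\,\Gamma\in\mathfrak H_0,$$ and for all $x>0$ $$p_h\,\mathbb E\{\Gamma(x\bullet Y^{[h]})\,\mathbf 1(x\|Y^{[h]}\|_t>1)\}=p_t\,x^{\alpha}\,\mathbb E\{\Gamma(Y^{[t]})\,\mathbf 1(\|Y^{[t]}\|_h>x)\},\qquad\forall\,\Gamma\in\mathfrak H.$$ (c) The law of $Y^{[h]}$ agrees with that of $R\bullet\Theta^{[h]}$, $h\in\mathcal Q$, where $R$ is an $\alpha$-Pareto random variable independent of $\Theta^{[h]}$. Moreover, $Y^{[h]}$, $h\in\mathcal Q$ with $p_h>0$, uniquely determine $\nu$.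
   Context: Setting. $\mathrm D$ is a non-empty set with $\sigma$-field $\mathscr D$, equipped with a pairing $(z,f)\mapsto z\bullet f\in\mathrm D$, $z\in(0,\infty)$, $f\in\mathrm D$, with $1\bullet f=f$ and $(z_1z_2)\bullet f=z_1\bullet(z_2\bullet f)$, which is $\mathscr B((0,\infty))\otimes\mathscr D/\mathscr D$-measurable. $\mathcal Q=\{t_i,i\in\mathbb N\}$ is a non-empty countable subset of some parameter space $\mathcal T$. For every $t\in\mathcal Q$ there is a $\mathscr D/\mathscr B([0,\infty])$-measurable map $\|\cdot\|_t:\mathrm D\to[0,\infty]$ with $\|z\bullet f\|_t=z\|f\|_t$ for all $z>0$, $f\in\mathrm D$, and such that $\|f\|_t\in(0,\infty)$ for some $f\in\mathrm D$. Function classes. $\mathfrak H$ is the class of all measurable maps $\Gamma:\mathrm D\to\mathbb R$ and all measurable maps $\Gamma:\mathrm D\to[0,\infty]$. $\mathfrak H_0$ is the class of $\Gamma\in\mathfrak H$ with $\Gamma(c\bullet f)=\Gamma(f)$ for all $c>0$, $f\in\mathrm D$. Tail measure. A measure $\nu$ on $\mathscr D$ is a tail measure with index $\alpha>0$ if: $\nu(z\bullet A)=z^{-\alpha}\nu(A)$ for all $z>0$, $A\in\mathscr D$; $\nu(\{f:\sup_{t\in\mathcal Q}\|f\|_t=0\})=0$; and $p_h:=\nu(\{f:\|f\|_h>1\})<\infty$ for all $h\in\mathcal Q$, with $p_{h_0}\in(0,\infty)$ for some $h_0\in\mathcal Q$. Local processes. If $p_h>0$, the local tail process $Y^{[h]}$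 of $\nu$ at $h$ is a $\mathrm D$-valued random element with law $A\mapsto\nu(\{f\in A:\|f\|_h>1\})/p_h$, and the local spectral tail process is $\Theta^{[h]}=(\|Y^{[h]}\|_h)^{-1}\bullet Y^{[h]}$. If $p_h=0$ one sets $Y^{[h]}=R\bullet g$, $\Theta^{[h]}=g$ with some $g\in\mathrm D$ satisfying $\|g\|_h=1$. An $\alpha$-Pareto random variable $R$ satisfies $\mathbb P\{R>t\}=t^{-\alpha}$, $t\ge1$; $R$ is taken independent of all other random elements.
   Formalization: Uniqueness of ν is stated for the local tail processes together with the weights p_h, h in Q: the processes alone cannot determine ν, since ν and 2ν have the same local tail processes Y^{[h]}. *)

theory Defs
  imports "HOL-Probability.Probability"
begin

text \<open>The Borel space of the open half-line \<open>(0, \<infinity>)\<close> of scaling factors.\<close>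

abbreviation pos_borel :: "real measure" where
  "pos_borel \<equiv> restrict_space borel {0<..}"

text \<open>
  The measurable space \<open>D\<close> plays the role of both the set and its sigma-field. The pairing
  \<open>act z f\<close> is meaningful only for \<open>z > 0\<close> and \<open>f \<in> space D\<close>; that it maps into \<open>space D\<close> is
  part of its measurability. The parameter space containing \<open>Q\<close> is the type \<open>'t\<close>.
\<close>

locale tail_setting =
  fixes D :: "'d measure"
    and act :: "real \<Rightarrow> 'd \<Rightarrow> 'd"
    and Q :: "'t set"
    and nrm :: "'t \<Rightarrow> 'd \<Rightarrow> ennreal"
  assumes space_nonempty: "space D \<noteq> {}"
    and act_measurable: "(\<lambda>(z, f). act z f) \<in> pos_borel \<Otimes>\<^sub>M D \<rightarrow>\<^sub>M D"
    and act_one: "\<And>f. f \<in> space D \<Longrightarrow> act 1 f = f"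
    and act_mult: "\<And>z\<^sub>1 z\<^sub>2 f. z\<^sub>1 > 0 \<Longrightarrow> z\<^sub>2 > 0 \<Longrightarrow> f \<in> space D
                     \<Longrightarrow> act (z\<^sub>1 * z\<^sub>2) f = act z\<^sub>1 (act z\<^sub>2 f)"
    and Q_nonempty: "Q \<noteq> {}"
    and Q_countable: "countable Q"
    and nrm_measurable: "\<And>t. t \<in> Q \<Longrightarrow> nrm t \<in> borel_measurable D"
    and nrm_act: "\<And>t z f. t \<in> Q \<Longrightarrow> z > 0 \<Longrightarrow> f \<in> space D \<Longrightarrow> nrm t (act z f) = ennreal z * nrm t f"
    and nrm_nontrivial: "\<And>t. t \<in> Q \<Longrightarrow> \<exists>f\<in>space D. 0 < nrm t f \<and> nrm t f < \<infinity>"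

text \<open>
  The class of all measurable maps into the reals and all measurable maps into \<open>[0, \<infinity>]\<close>;
  both targets are embedded in the extended reals, so that one expectation serves for both.
\<close>

definition class_H :: "'d measure \<Rightarrow> ('d \<Rightarrow> ereal) set" where
  "class_H D = {\<lambda>f. ereal (G f) | G. G \<in> borel_measurable D}
             \<union> {\<lambda>f. enn2ereal (G f) | G. G \<in> borel_measurable D}"

definition class_H0 :: "'d measure \<Rightarrow> (real \<Rightarrow> 'd \<Rightarrow> 'd) \<Rightarrow> ('d \<Rightarrow> ereal) set" where
  "class_H0 D act = {\<Gamma> \<in> class_H D. \<forall>c>0. \<forall>f\<in>space D. \<Gamma> (act c f) = \<Gamma> f}"

definition tail_weight :: "('t \<Rightarrow> 'd \<Rightarrow> ennreal) \<Rightarrow> 'd measure \<Rightarrow> 't \<Rightarrow> ennreal" where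
  "tail_weight nrm \<nu> h = emeasure \<nu> {f \<in> space \<nu>. nrm h f > 1}"

definition tail_measure ::
  "'d measure \<Rightarrow> (real \<Rightarrow> 'd \<Rightarrow> 'd) \<Rightarrow> 't set \<Rightarrow> ('t \<Rightarrow> 'd \<Rightarrow> ennreal) \<Rightarrow> real \<Rightarrow> 'd measure \<Rightarrow> bool"
where
  "tail_measure D act Q nrm \<alpha> \<nu> \<longleftrightarrow>
     \<alpha> > 0 \<and>
     sets \<nu> = sets D \<and>
     (\<forall>z>0. \<forall>A\<in>sets D. emeasure \<nu> (act z ` A) = ennreal (z powr (-\<alpha>)) * emeasure \<nu> A) \<and>
     emeasure \<nu> {f \<in> space D. (SUP t\<in>Q. nrm t f) = 0} = 0 \<and>
     (\<forall>h\<in>Q. tail_weight nrm \<nu> h < \<infinity>) \<and>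
     (\<exists>h\<in>Q. 0 < tail_weight nrm \<nu> h \<and> tail_weight nrm \<nu> h < \<infinity>)"

text \<open>An \<open>\<alpha>\<close>-Pareto random variable takes values in \<open>(0, \<infinity>)\<close>, so that it can act on \<open>D\<close>.\<close>

definition pareto_rv :: "'w measure \<Rightarrow> real \<Rightarrow> ('w \<Rightarrow> real) \<Rightarrow> bool" where
  "pareto_rv \<Omega> \<alpha> R \<longleftrightarrow>
     R \<in> \<Omega> \<rightarrow>\<^sub>M pos_borel \<and>
     (\<forall>t\<ge>1. measure \<Omega> {\<omega> \<in> space \<Omega>. R \<omega> > t} = t powr (-\<alpha>))"

text \<open>
  Independence of two random elements, that is, of the sigma-fields they generate. The library's
  \<open>indep_var\<close> requires both to have the same value type.
\<close>

definition indep_rvs ::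
  "'w measure \<Rightarrow> 'a measure \<Rightarrow> ('w \<Rightarrow> 'a) \<Rightarrow> 'b measure \<Rightarrow> ('w \<Rightarrow> 'b) \<Rightarrow> bool"
where
  "indep_rvs \<Omega> M X N Z \<longleftrightarrow>
     X \<in> \<Omega> \<rightarrow>\<^sub>M M \<and> Z \<in> \<Omega> \<rightarrow>\<^sub>M N \<and>
     prob_space.indep_set \<Omega> (sets (vimage_algebra (space \<Omega>) X M)) (sets (vimage_algebra (space \<Omega>) Z N))"

text \<open>The law \<open>A \<mapsto> \<nu> {f \<in> A. nrm h f > 1} / p\<^sub>h\<close>.\<close>

definition local_tail_law :: "('t \<Rightarrow> 'd \<Rightarrow> ennreal) \<Rightarrow> 'd measure \<Rightarrow> 't \<Rightarrow> 'd measure" where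
  "local_tail_law nrm \<nu> h = uniform_measure \<nu> {f \<in> space \<nu>. nrm h f > 1}"

text \<open>
  \<open>Y\<close> and \<open>\<Theta>\<close> are a local tail process of \<open>\<nu>\<close> at \<open>h\<close> and the local spectral tail process derived
  from it. Since only positive reals act on \<open>D\<close>, the formula for \<open>\<Theta>\<close> makes sense only where
  \<open>nrm h Y\<close> lies in \<open>(0, \<infinity>)\<close>; elsewhere \<open>\<Theta>\<close> is an unspecified element of \<open>D\<close>.
\<close>

definition local_processes ::
  "'d measure \<Rightarrow> (real \<Rightarrow> 'd \<Rightarrow> 'd) \<Rightarrow> ('t \<Rightarrow> 'd \<Rightarrow> ennreal) \<Rightarrow> real \<Rightarrow> 'd measure \<Rightarrow>
   'w measure \<Rightarrow> 't \<Rightarrow> ('w \<Rightarrow> 'd) \<Rightarrow> ('w \<Rightarrow> 'd) \<Rightarrow> bool"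
where
  "local_processes D act nrm \<alpha> \<nu> \<Omega> h Y \<Theta> \<longleftrightarrow>
     Y \<in> \<Omega> \<rightarrow>\<^sub>M D \<and> \<Theta> \<in> \<Omega> \<rightarrow>\<^sub>M D \<and>
     (if tail_weight nrm \<nu> h > 0
      then distr \<Omega> D Y = local_tail_law nrm \<nu> h \<and>
           (\<forall>\<omega>\<in>space \<Omega>. 0 < nrm h (Y \<omega>) \<and> nrm h (Y \<omega>) < \<infinity> \<longrightarrow>
              \<Theta> \<omega> = act (inverse (enn2real (nrm h (Y \<omega>)))) (Y \<omega>))
      else \<exists>R g. pareto_rv \<Omega> \<alpha> R \<and> g \<in> space D \<and> nrm h g = 1 \<and>
           (\<forall>\<omega>\<in>space \<Omega>. Y \<omega> = act (R \<omega>) g \<and> \<Theta> \<omega> = g))"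

definition ennreal_powr :: "ennreal \<Rightarrow> real \<Rightarrow> ennreal" where
  "ennreal_powr x a = (if x = \<infinity> then \<infinity> else ennreal (enn2real x powr a))"

text \<open>
  Expectation of an extended real random variable as the difference of the expectations of its
  positive and negative parts. It exists unless both are infinite.
\<close>

definition expect_exists :: "'w measure \<Rightarrow> ('w \<Rightarrow> ereal) \<Rightarrow> bool" where
  "expect_exists \<Omega> X \<longleftrightarrow>
     (\<integral>\<^sup>+\<omega>. e2ennreal (X \<omega>) \<partial>\<Omega>) < \<infinity> \<or> (\<integral>\<^sup>+\<omega>. e2ennreal (- X \<omega>) \<partial>\<Omega>) < \<infinity>"

definition expect :: "'w measure \<Rightarrow> ('w \<Rightarrow> ereal) \<Rightarrow> ereal" where
  "expect \<Omega> X = enn2ereal (\<integral>\<^sup>+\<omega>. e2ennreal (X \<omega>) \<partial>\<Omega>) - enn2ereal (\<integral>\<^sup>+\<omega>. e2ennreal (- X \<omega>) \<partial>\<Omega>)"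

end

theory Submission
  imports Defs
begin

text \<open>
  Homogeneity of a tail measure \<open>\<nu>\<close> says that \<open>act z\<close> maps \<open>\<nu>\<close> to \<open>z\<^sup>\<alpha> \<nu>\<close>, that is,
  \<open>\<integral> G (act z f) \<nu>(df) = z\<^sup>\<alpha> \<integral> G d\<nu>\<close> (\<open>nn_integral_act\<close>). Everything rests on this change of
  variables. A set of finite mass that the action preserves is null, so every \<open>nrm h\<close> is finite almost
  everywhere; and \<open>p h = 0\<close> forces \<open>{f. nrm h f > x}\<close> to be null for every \<open>x > 0\<close>. Both facts pass
  to \<open>Y\<close> and \<open>\<Theta>\<close> because, for \<open>p h > 0\<close>, the law of \<open>Y h\<close> is \<open>\<nu>\<close> conditioned on
  \<open>{f. nrm h f > 1}\<close>; thus expectations of functions of \<open>Y h\<close> and \<open>\<Theta> h\<close>, multiplied by \<open>p h\<close>, are integrals against \<open>\<nu>\<close>. The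
  change of reference coordinate for the tail processes is the change of variables itself.

  The statements about \<open>\<Theta>\<close> come from one identity (\<open>polar_identity\<close>). Write \<open>W = nrm h\<close> and
  \<open>V = nrm t\<close>. For every measurable \<open>F \<ge> 0\<close>,
  \<open>\<integral> 1(W f > 1) W(f)\<^sup>-\<^sup>\<alpha> \<integral> \<alpha> s\<^sup>-\<^sup>\<alpha>\<^sup>-\<^sup>1 1(s V f > 1) F (act s f) ds \<nu>(df)
    = \<integral> 1(V f > 1, W f > 0) F f \<nu>(df)\<close>.
  After exchanging the integrals, the change of variables for each fixed \<open>s\<close> moves the scaling off \<open>F\<close>,
  and the remaining integral of \<open>\<alpha> s\<^sup>\<alpha>\<^sup>-\<^sup>1\<close> over \<open>0 < s < W f\<close> equals \<open>W(f)\<^sup>\<alpha>\<close>. When \<open>F\<close> is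
  invariant under scaling, the inner integral is \<open>V(f)\<^sup>\<alpha> F f\<close>, and the identity becomes the change of
  reference coordinate for spectral tail processes. When \<open>t = h\<close>, the substitution \<open>r = s W f\<close> turns
  \<open>W(f)\<^sup>-\<^sup>\<alpha>\<close> times the inner integral into the expectation of \<open>F\<close> at a Pareto multiple of \<open>f\<close>
  normalised to norm one, so the identity says that \<open>Y h\<close> is distributed as \<open>R\<close> acting on \<open>\<Theta> h\<close>.

  For uniqueness, the weights and local laws fix \<open>\<nu>\<close> on the subsets of each \<open>{f. nrm h f > 1}\<close>. They
  also fix the index, since \<open>\<nu> {f. nrm h f > 2} = 2\<^sup>-\<^sup>\<alpha> p h\<close>. Homogeneity then fixes \<open>\<nu>\<close> on the
  subsets of \<open>{f. nrm h f > x}\<close> for every \<open>x > 0\<close>, and countably many of these sets cover all but a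
  null set.

  Expectations of signed variables reduce to nonnegative ones: each identity holds for the positive and
  the negative part separately, with the same positive finite constants, so one side exists exactly when
  the other does (\<open>expect_transfer\<close>).
\<close>

section \<open>Power integrals on the half-line\<close>

abbreviation half_line :: "real measure" where
  "half_line \<equiv> restrict_space lborel {0<..}"

abbreviation power_density :: "real \<Rightarrow> real \<Rightarrow> ennreal" where
  "power_density a s \<equiv> ennreal (a * s powr (- a - 1))"

lemma sigma_finite_half_line: "sigma_finite_measure half_line"
  by (intro sigma_finite_measure_restrict_space sigma_finite_lborel) simp

lemma sets_half_line [measurable_cong]: "sets half_line = sets pos_borel"
  by (rule sets_restrict_space_cong) simp

lemma id_pos_borel [measurable]: "(\<lambda>s. s) \<in> borel_measurable pos_borel"
  by (rule measurable_restrict_space1) simp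

lemma id_half_line [measurable]: "(\<lambda>s. s) \<in> borel_measurable half_line"
  by (rule measurable_restrict_space1) simp

lemma nn_integral_power_above:
  assumes a: "a > 0" and c: "c > 0"
  shows "(\<integral>\<^sup>+s. power_density a s * of_bool (s > c) \<partial>half_line) = ennreal (c powr (- a))"
proof -
  have "((\<lambda>x. x powr (- a - 1)) has_integral (c powr (- a) / a)) {c..}"
    using has_integral_powr_to_inf[of "- a - 1" c] a c by (simp add: field_simps)
  from has_integral_mult_right[OF this, of a]
  have "((\<lambda>x. a * x powr (- a - 1)) has_integral (c powr (- a))) {c..}"
    using a by simp
  then have "(\<integral>\<^sup>+s. power_density a s * indicator {c..} s \<partial>lborel) = ennreal (c powr (- a))"
    using a by (intro nn_integral_has_integral_lebesgue') auto
  moreover have "(\<integral>\<^sup>+s. power_density a s * of_bool (s > c) * indicator {0<..} s \<partial>lborel)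
      = (\<integral>\<^sup>+s. power_density a s * indicator {c..} s \<partial>lborel)"
    using c AE_lborel_singleton[of c]
    by (intro nn_integral_cong_AE) (auto split: split_indicator elim!: eventually_mono)
  ultimately show ?thesis by (subst nn_integral_restrict_space) simp_all
qed

lemma nn_integral_power_below:
  assumes a: "a > 0" and c: "c \<ge> 0"
  shows "(\<integral>\<^sup>+s. ennreal (a * s powr (a - 1)) * of_bool (s < c) \<partial>half_line) = ennreal (c powr a)"
proof -
  have "((\<lambda>x. x powr (a - 1)) has_integral (c powr a / a)) {0..c}"
    using has_integral_powr_from_0[of "a - 1" c] a c by simp
  from has_integral_mult_right[OF this, of a]
  have "((\<lambda>x. a * x powr (a - 1)) has_integral (c powr a)) {0..c}"
    using a by simp
  then have "(\<integral>\<^sup>+s. ennreal (a * s powr (a - 1)) * indicator {0..c} s \<partial>lborel) = ennreal (c powr a)"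
    using a by (intro nn_integral_has_integral_lebesgue') auto
  moreover have "(\<integral>\<^sup>+s. ennreal (a * s powr (a - 1)) * of_bool (s < c) * indicator {0<..} s \<partial>lborel)
      = (\<integral>\<^sup>+s. ennreal (a * s powr (a - 1)) * indicator {0..c} s \<partial>lborel)"
    using c AE_lborel_singleton[of c] AE_lborel_singleton[of 0]
    by (intro nn_integral_cong_AE) (auto split: split_indicator elim!: eventually_elim2)
  ultimately show ?thesis by (subst nn_integral_restrict_space) simp_all
qed

lemma nn_integral_half_line_scale:
  assumes g [measurable]: "g \<in> borel_measurable pos_borel" and c: "c > 0"
  shows "(\<integral>\<^sup>+s. g s \<partial>half_line) = ennreal c * (\<integral>\<^sup>+s. g (c * s) \<partial>half_line)"
proof -
  have m: "(\<lambda>s. g s * indicator {0<..} s) \<in> borel_measurable borel"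
    using g by (subst (asm) borel_measurable_restrict_space_iff_ennreal) simp_all
  have "(\<integral>\<^sup>+s. g s \<partial>half_line) = (\<integral>\<^sup>+s. g s * indicator {0<..} s \<partial>lborel)"
    by (rule nn_integral_restrict_space) simp
  also have "\<dots> = ennreal c * (\<integral>\<^sup>+s. g (c * s) * indicator {0<..} (c * s) \<partial>lborel)"
    using nn_integral_real_affine[OF m, of c 0] c by simp
  also have "(\<integral>\<^sup>+s. g (c * s) * indicator {0<..} (c * s) \<partial>lborel)
      = (\<integral>\<^sup>+s. g (c * s) * indicator {0<..} s \<partial>lborel)"
    using c by (intro nn_integral_cong) (auto simp: zero_less_mult_iff split: split_indicator)
  also have "\<dots> = (\<integral>\<^sup>+s. g (c * s) \<partial>half_line)"
    by (rule nn_integral_restrict_space[symmetric]) simp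
  finally show ?thesis .
qed

section \<open>Pareto variables\<close>

text \<open>
  Only the tail above \<open>1\<close> is prescribed, but at \<open>1\<close> it is already \<open>1\<close>; so the tail function is known on the
  whole line, and it determines the law.
\<close>

lemma (in prob_space) distr_pareto:
  assumes R: "pareto_rv M a R" and a: "a > 0"
  shows "distr M pos_borel R = density half_line (\<lambda>r. power_density a r * of_bool (r > 1))"
    (is "?L = ?P")
proof -
  have Rm [measurable]: "R \<in> M \<rightarrow>\<^sub>M pos_borel" and
    tail: "\<And>t. t \<ge> 1 \<Longrightarrow> prob {\<omega> \<in> space M. R \<omega> > t} = t powr (- a)"
    using R by (auto simp: pareto_rv_def)
  have [measurable]: "R \<in> borel_measurable M"
    using measurable_compose[OF Rm id_pos_borel] .
  have "distr M borel R = distr ?P borel (\<lambda>r. r)"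
  proof (rule measure_eqI_lessThan)
    fix x :: real
    let ?m = "max x 1"
    have P: "emeasure (distr ?P borel (\<lambda>r. r)) {x<..} = ennreal (?m powr (- a))"
    proof -
      have "emeasure (distr ?P borel (\<lambda>r. r)) {x<..} = emeasure ?P ({x<..} \<inter> {0<..})"
        by (subst emeasure_distr) (simp_all add: space_restrict_space)
      also have "\<dots> = (\<integral>\<^sup>+r. power_density a r * of_bool (r > 1)
          * indicator ({x<..} \<inter> {0<..}) r \<partial>half_line)"
        by (subst emeasure_density) (auto simp: sets_restrict_space)
      also have "\<dots> = (\<integral>\<^sup>+r. power_density a r * of_bool (r > ?m) \<partial>half_line)"
        by (intro nn_integral_cong) (auto split: split_indicator simp: space_restrict_space)
      also have "\<dots> = ennreal (?m powr (- a))"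
        using a by (intro nn_integral_power_above) auto
      finally show ?thesis .
    qed
    have le: "prob {\<omega> \<in> space M. R \<omega> > x} \<ge> 1" if "x < 1"
    proof -
      have "1 = prob {\<omega> \<in> space M. R \<omega> > 1}" using tail[of 1] by simp
      also have "\<dots> \<le> prob {\<omega> \<in> space M. R \<omega> > x}"
        using that by (intro finite_measure_mono) auto
      finally show ?thesis .
    qed
    have "prob {\<omega> \<in> space M. R \<omega> > x} = ?m powr (- a)"
      using tail[of x] le prob_le_1[of "{\<omega> \<in> space M. R \<omega> > x}"]
      by (cases "x < 1") (auto simp: max_def)
    then have L: "emeasure (distr M borel R) {x<..} = ennreal (?m powr (- a))"
      by (subst emeasure_distr) (simp_all add: emeasure_eq_measure vimage_def Int_def conj_commute)
    show "emeasure (distr M borel R) {x<..} = emeasure (distr ?P borel (\<lambda>r. r)) {x<..}"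
      using L P by simp
    show "emeasure (distr M borel R) {x<..} < \<infinity>" using L by simp
  qed simp_all
  then have *: "emeasure (distr M borel R) A = emeasure (distr ?P borel (\<lambda>r. r)) A" for A
    by simp
  show ?thesis
  proof (rule measure_eqI)
    fix A assume "A \<in> sets ?L"
    then have A: "A \<in> sets borel" "A \<subseteq> {0<..}" "A \<in> sets pos_borel"
      by (auto simp: sets_restrict_space)
    have "emeasure ?L A = emeasure (distr M borel R) A"
      using A by (simp add: emeasure_distr)
    also have "\<dots> = emeasure (distr ?P borel (\<lambda>r. r)) A" by (rule *)
    also have "\<dots> = emeasure ?P A"
      using A by (subst emeasure_distr) (auto simp: space_restrict_space Int_absorb2)
    finally show "emeasure ?L A = emeasure ?P A" .
  qed (simp add: sets_half_line)
qed

text \<open>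
  The two \<open>\<sigma>\<close>-fields generated consist of preimages, so independence is the product formula on rectangles,
  which determines the joint law.
\<close>

lemma (in prob_space) distr_pair_indep_rvs:
  assumes I: "indep_rvs M S X T Z"
  shows "distr M (S \<Otimes>\<^sub>M T) (\<lambda>\<omega>. (X \<omega>, Z \<omega>)) = distr M S X \<Otimes>\<^sub>M distr M T Z"
proof -
  have X [measurable]: "X \<in> M \<rightarrow>\<^sub>M S" and Z [measurable]: "Z \<in> M \<rightarrow>\<^sub>M T"
    and ind: "indep_set (sets (vimage_algebra (space M) X S)) (sets (vimage_algebra (space M) Z T))"
    using I by (auto simp: indep_rvs_def)
  interpret X: prob_space "distr M S X" by (rule prob_space_distr) fact
  interpret Z: prob_space "distr M T Z" by (rule prob_space_distr) fact
  show ?thesis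
  proof (rule pair_measure_eqI[symmetric])
    fix A B assume "A \<in> sets (distr M S X)" "B \<in> sets (distr M T Z)"
    then have A [measurable]: "A \<in> sets S" and B [measurable]: "B \<in> sets T" by auto
    have A': "X -` A \<inter> space M \<in> sets (vimage_algebra (space M) X S)"
      and B': "Z -` B \<inter> space M \<in> sets (vimage_algebra (space M) Z T)"
      using A B by (auto intro: in_vimage_algebra)
    have "emeasure (distr M (S \<Otimes>\<^sub>M T) (\<lambda>\<omega>. (X \<omega>, Z \<omega>))) (A \<times> B)
        = prob ((X -` A \<inter> space M) \<inter> (Z -` B \<inter> space M))"
      by (subst emeasure_distr) (auto simp: emeasure_eq_measure intro!: arg_cong[where f=prob])
    also have "\<dots> = prob (X -` A \<inter> space M) * prob (Z -` B \<inter> space M)"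
      by (subst indep_setD[OF ind A' B']) simp
    finally show "emeasure (distr M S X) A * emeasure (distr M T Z) B
        = emeasure (distr M (S \<Otimes>\<^sub>M T) (\<lambda>\<omega>. (X \<omega>, Z \<omega>))) (A \<times> B)"
      by (simp add: emeasure_distr emeasure_eq_measure ennreal_mult)
  qed (simp_all add: X.sigma_finite_measure_axioms Z.sigma_finite_measure_axioms
    cong: sets_pair_measure_cong)
qed

section \<open>Expectations of extended real variables\<close>

lemma e2ennreal_mult_enn2ereal: "e2ennreal (enn2ereal a * y) = a * e2ennreal y"
proof (cases "y \<ge> 0")
  case True
  then show ?thesis
    by (metis e2ennreal_enn2ereal enn2ereal_e2ennreal times_ennreal.rep_eq)
next
  case False
  then have "enn2ereal a * y \<le> 0" by (simp add: ereal_mult_le_0_iff)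
  with False show ?thesis by (simp add: e2ennreal_neg)
qed

lemma of_bool_enn2ereal: "(of_bool b :: ereal) = enn2ereal (of_bool b)"
  by (cases b) (simp_all add: zero_ennreal.rep_eq one_ennreal.rep_eq)

text \<open>
  Both parts satisfy the same proportionality, and the factors are positive and finite; finiteness of each
  part and then the difference carry over.
\<close>

lemma expect_transfer:
  assumes c: "0 < c" "c < \<infinity>" and d: "0 < d" "d < \<infinity>"
    and pos: "c * (\<integral>\<^sup>+\<omega>. e2ennreal (X \<omega>) \<partial>M) = d * (\<integral>\<^sup>+\<omega>. e2ennreal (Z \<omega>) \<partial>N)"
    and neg: "c * (\<integral>\<^sup>+\<omega>. e2ennreal (- X \<omega>) \<partial>M) = d * (\<integral>\<^sup>+\<omega>. e2ennreal (- Z \<omega>) \<partial>N)"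
  shows "expect_exists M X \<longleftrightarrow> expect_exists N Z"
    and "enn2ereal c * expect M X = enn2ereal d * expect N Z"
proof -
  have fin: "x < \<infinity> \<longleftrightarrow> y < \<infinity>" if "c * x = d * y" for x y
    proof -
    have "x < \<infinity> \<longleftrightarrow> c * x < \<infinity>" "y < \<infinity> \<longleftrightarrow> d * y < \<infinity>"
      using c d by (auto simp: ennreal_mult_less_top)
    with that show ?thesis by simp
  qed
  show "expect_exists M X \<longleftrightarrow> expect_exists N Z"
    unfolding expect_exists_def using fin[OF pos] fin[OF neg] by simp
  have distrib: "enn2ereal k * (enn2ereal x - enn2ereal y) = enn2ereal (k * x) - enn2ereal (k * y)"
    if k: "0 < k" "k < \<infinity>" for k x y
  proof -
    obtain r where r: "r > 0" "enn2ereal k = ereal r"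
      using k by (cases k) (auto simp: ennreal_less_iff enn2ereal_ennreal)
    show ?thesis
      unfolding times_ennreal.rep_eq r(2) using r(1)
      by (cases "enn2ereal x"; cases "enn2ereal y") (auto simp: algebra_simps)
  qed
  show "enn2ereal c * expect M X = enn2ereal d * expect N Z"
    unfolding expect_def using distrib[OF c] distrib[OF d] pos neg by simp
qed

section \<open>The scaling action and the norms\<close>

lemma ennreal_cancel_left:
  fixes c x y :: ennreal
  assumes "0 < c" "c < \<infinity>" "c * x = c * y"
  shows "x = y"
  using assms by (auto simp: ennreal_mult_cancel_left)

lemma ennreal_powr_measurable [measurable]: "(\<lambda>x. ennreal_powr x a) \<in> borel_measurable borel"
  unfolding ennreal_powr_def by measurable

lemma ennreal_less_mult_iff: "x > 0 \<Longrightarrow> ennreal x < ennreal x * y \<longleftrightarrow> 1 < y"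
  by (cases y) (auto simp: ennreal_less_iff ennreal_mult_top ennreal_mult[symmetric] simp flip: ennreal_1)

context tail_setting
begin

lemma act_closed: "z > 0 \<Longrightarrow> f \<in> space D \<Longrightarrow> act z f \<in> space D"
  using measurable_space[OF act_measurable, of "(z, f)"]
  by (simp add: space_pair_measure space_restrict_space)

lemma measurable_act_comp:
  assumes "u \<in> M \<rightarrow>\<^sub>M pos_borel" "v \<in> M \<rightarrow>\<^sub>M D"
  shows "(\<lambda>x. act (u x) (v x)) \<in> M \<rightarrow>\<^sub>M D"
  using measurable_compose[OF measurable_Pair[OF assms] act_measurable] by simp

lemma measurable_orbit: "f \<in> space D \<Longrightarrow> (\<lambda>s. act s f) \<in> half_line \<rightarrow>\<^sub>M D"
  by (rule measurable_act_comp) (simp_all add: measurable_cong_sets[OF sets_half_line refl])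

lemma measurable_act: "z > 0 \<Longrightarrow> act z \<in> D \<rightarrow>\<^sub>M D"
  by (rule measurable_act_comp[of "\<lambda>_. z" D "\<lambda>f. f"]) (simp_all add: space_restrict_space)

lemma act_inverse: "z > 0 \<Longrightarrow> f \<in> space D \<Longrightarrow> act (inverse z) (act z f) = f"
  using act_mult[of "inverse z" z f] act_one by simp

text \<open>
  Homogeneity of a tail measure is formulated with images under the action; this turns them into preimages,
  and in particular shows that they are measurable.
\<close>

lemma act_vimage:
  assumes z: "z > 0" and A: "A \<subseteq> space D"
  shows "act z -` A \<inter> space D = act (inverse z) ` A"
proof (intro equalityI subsetI)
  fix f assume "f \<in> act z -` A \<inter> space D"
  then show "f \<in> act (inverse z) ` A"
    using act_inverse[OF z] by (metis IntE imageI vimageD)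
next
  fix f assume "f \<in> act (inverse z) ` A"
  then show "f \<in> act z -` A \<inter> space D"
    using A z act_inverse[of "inverse z"] by (auto intro!: act_closed)
qed

lemma nrm_positive_iff: "nrm h f > 0 \<longleftrightarrow> (\<exists>n. nrm h f > ennreal (1 / Suc n))"
proof
  assume p: "nrm h f > 0"
  show "\<exists>n. nrm h f > ennreal (1 / Suc n)"
  proof (cases "nrm h f")
    case (real r)
    with p have "r > 0" by simp
    then obtain n where "1 / Suc n < r"
      using reals_Archimedean[of r] by (auto simp: inverse_eq_divide)
    then show ?thesis using real by (auto simp: ennreal_less_iff simp del: of_nat_Suc)
  qed (auto intro!: exI[of _ 0])
qed (auto intro: le_less_trans zero_le)

end

locale tail_measure_setting = tail_setting D act Q nrm
  for D :: "'d measure" and act :: "real \<Rightarrow> 'd \<Rightarrow> 'd" and Q :: "'t set" and nrm :: "'t \<Rightarrow> 'd \<Rightarrow> ennreal" +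
  fixes \<alpha> :: real and \<nu> :: "'d measure"
  assumes tail: "tail_measure D act Q nrm \<alpha> \<nu>"
begin

abbreviation p :: "'t \<Rightarrow> ennreal" where "p \<equiv> tail_weight nrm \<nu>"

abbreviation rnrm :: "'t \<Rightarrow> 'd \<Rightarrow> real" where "rnrm h f \<equiv> enn2real (nrm h f)"

lemma alpha_pos: "\<alpha> > 0"
  using tail by (simp add: tail_measure_def)

lemma sets_tail [simp, measurable_cong]: "sets \<nu> = sets D"
  using tail by (simp add: tail_measure_def)

lemma space_tail [simp]: "space \<nu> = space D"
  by (rule sets_eq_imp_space_eq) simp

lemma nrm_tail_measurable [measurable]: "h \<in> Q \<Longrightarrow> nrm h \<in> borel_measurable D"
  by (rule nrm_measurable)

lemma weight_finite: "h \<in> Q \<Longrightarrow> p h < \<infinity>"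
  using tail by (auto simp: tail_measure_def)

lemma weight_eq: "p h = emeasure \<nu> {f \<in> space D. nrm h f > 1}"
  by (simp add: tail_weight_def)

lemma distr_act:
  assumes z: "z > 0"
  shows "distr \<nu> D (act z) = scale_measure (ennreal (z powr \<alpha>)) \<nu>"
proof (rule measure_eqI)
  fix A assume "A \<in> sets (distr \<nu> D (act z))"
  then have A: "A \<in> sets D" by simp
  have m: "act z \<in> \<nu> \<rightarrow>\<^sub>M D" using measurable_act[OF z] by simp
  have "emeasure (distr \<nu> D (act z)) A = emeasure \<nu> (act (inverse z) ` A)"
    using A m by (simp add: emeasure_distr act_vimage[OF z sets.sets_into_space])
  also have "\<dots> = ennreal (inverse z powr (- \<alpha>)) * emeasure \<nu> A"
    using tail z A by (auto simp: tail_measure_def)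
  also have "inverse z powr (- \<alpha>) = z powr \<alpha>"
    using z by (simp add: powr_minus inverse_powr)
  finally show "emeasure (distr \<nu> D (act z)) A = emeasure (scale_measure (ennreal (z powr \<alpha>)) \<nu>) A"
    by simp
qed simp

lemma nn_integral_act:
  assumes z: "z > 0" and G: "G \<in> borel_measurable D"
  shows "(\<integral>\<^sup>+f. G (act z f) \<partial>\<nu>) = ennreal (z powr \<alpha>) * (\<integral>\<^sup>+f. G f \<partial>\<nu>)"
proof -
  have m: "act z \<in> \<nu> \<rightarrow>\<^sub>M D" using measurable_act[OF z] by simp
  have G': "G \<in> borel_measurable \<nu>" using G by simp
  have "(\<integral>\<^sup>+f. G (act z f) \<partial>\<nu>) = (\<integral>\<^sup>+f. G f \<partial>distr \<nu> D (act z))"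
    by (rule nn_integral_distr[symmetric]) (use m G in auto)
  also have "\<dots> = ennreal (z powr \<alpha>) * (\<integral>\<^sup>+f. G f \<partial>\<nu>)"
    unfolding distr_act[OF z] by (rule nn_integral_scale_measure) fact
  finally show ?thesis .
qed

lemma emeasure_nrm_greater:
  assumes h: "h \<in> Q" and x: "x > 0"
  shows "emeasure \<nu> {f \<in> space D. nrm h f > ennreal x} = ennreal (x powr (- \<alpha>)) * p h"
proof -
  have "(\<integral>\<^sup>+f. indicator {f \<in> space D. nrm h f > ennreal x} (act x f) \<partial>\<nu>)
      = (\<integral>\<^sup>+f. indicator {f \<in> space D. nrm h f > 1} f \<partial>\<nu>)"
  proof (rule nn_integral_cong)
    fix f assume f: "f \<in> space \<nu>"
    have "ennreal x < ennreal x * nrm h f \<longleftrightarrow> 1 < nrm h f"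
      using x by (rule ennreal_less_mult_iff)
    then show "indicator {f \<in> space D. nrm h f > ennreal x} (act x f)
        = (indicator {f \<in> space D. nrm h f > 1} f :: ennreal)"
      using f x h act_closed by (auto simp: nrm_act split: split_indicator)
  qed
  then have "p h = ennreal (x powr \<alpha>) * emeasure \<nu> {f \<in> space D. nrm h f > ennreal x}"
    using h x nn_integral_act[OF x, of "indicator {f \<in> space D. nrm h f > ennreal x}"]
    by (simp add: weight_eq)
  moreover have "ennreal (x powr (- \<alpha>)) * ennreal (x powr \<alpha>) = 1"
    using x by (simp flip: ennreal_mult powr_add)
  ultimately show ?thesis by (metis mult.assoc mult_1)
qed

text \<open>
  The set where the norm is infinite is invariant under scaling and has mass at most \<open>p h\<close>. Its mass \<open>m\<close>
  therefore satisfies \<open>m = 2\<^sup>\<alpha> m\<close> with \<open>m < \<infinity>\<close> and \<open>2\<^sup>\<alpha> > 1\<close>.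
\<close>

lemma nrm_finite_AE:
  assumes h: "h \<in> Q"
  shows "AE f in \<nu>. nrm h f < \<infinity>"
proof -
  let ?N = "{f \<in> space D. nrm h f = \<infinity>}"
  have N: "?N \<in> sets \<nu>" using h by simp
  have "emeasure \<nu> ?N \<le> p h"
    unfolding weight_eq using h by (intro emeasure_mono) auto
  then have fin: "emeasure \<nu> ?N < \<infinity>" using weight_finite[OF h] by simp
  have "(\<integral>\<^sup>+f. indicator ?N (act 2 f) \<partial>\<nu>) = (\<integral>\<^sup>+f. indicator ?N f \<partial>\<nu>)"
    using h act_closed[of 2]
    by (intro nn_integral_cong) (auto simp: nrm_act ennreal_mult_eq_top_iff split: split_indicator)
  then have "emeasure \<nu> ?N = ennreal (2 powr \<alpha>) * emeasure \<nu> ?N"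
    using nn_integral_act[of 2 "indicator ?N"] h by simp
  moreover have "2 powr \<alpha> > 1" using alpha_pos gr_one_powr[of 2 \<alpha>] by simp
  moreover obtain r where "r \<ge> 0" "emeasure \<nu> ?N = ennreal r"
    using fin by (cases "emeasure \<nu> ?N") auto
  ultimately have "emeasure \<nu> ?N = 0"
    by (auto simp flip: ennreal_mult)
  then show ?thesis
    by (intro AE_I[OF _ _ N]) (auto simp: less_top[symmetric])
qed

lemma nrm_zero_AE:
  assumes h: "h \<in> Q" and p: "p h = 0"
  shows "AE f in \<nu>. nrm h f = 0"
proof -
  have "AE f in \<nu>. \<forall>n. \<not> nrm h f > ennreal (1 / Suc n)"
  proof (unfold AE_all_countable, rule allI)
    fix n
    have "emeasure \<nu> {f \<in> space D. nrm h f > ennreal (1 / Suc n)} = 0"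
      by (subst emeasure_nrm_greater) (use h p in auto)
    then show "AE f in \<nu>. \<not> nrm h f > ennreal (1 / Suc n)"
      using h by (intro AE_I[where N="{f \<in> space D. nrm h f > ennreal (1 / Suc n)}"]) auto
  qed
  then show ?thesis
    by eventually_elim (use nrm_positive_iff in \<open>metis not_gr_zero\<close>)
qed

text \<open>
  The sets \<open>B k\<close> are the superlevel sets at the heights \<open>1 / (n + 1)\<close> of all the norms. They serve twice:
  each has finite mass, which gives \<open>\<sigma>\<close>-finiteness, and two tail measures that agree on the subsets of each
  of them agree everywhere.
\<close>

lemma exhaustion:
  obtains B :: "nat \<Rightarrow> 'd set" and q :: "nat \<Rightarrow> 't" and x :: "nat \<Rightarrow> real" where
    "\<And>k. q k \<in> Q" "\<And>k. x k > 0" "\<And>k. B k = {f \<in> space D. nrm (q k) f > ennreal (x k)}"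
    "{f \<in> space D. (SUP t\<in>Q. nrm t f) \<noteq> 0} = (\<Union>k. B k)"
proof -
  define g where "g k = (from_nat_into (Q \<times> (UNIV :: nat set)) k)" for k :: nat
  have g: "range g = Q \<times> UNIV"
    unfolding g_def using Q_nonempty Q_countable by (intro range_from_nat_into) auto
  then have gQ: "fst (g k) \<in> Q" for k by (metis mem_Times_iff rangeI)
  have "(SUP t\<in>Q. nrm t f) \<noteq> 0 \<longleftrightarrow> (\<exists>k. nrm (fst (g k)) f > ennreal (1 / Suc (snd (g k))))" for f
  proof -
    have "(SUP t\<in>Q. nrm t f) \<noteq> 0 \<longleftrightarrow> (\<exists>t\<in>Q. nrm t f > 0)"
      using Q_nonempty by (auto simp: less_SUP_iff simp flip: zero_less_iff_neq_zero)
    also have "\<dots> \<longleftrightarrow> (\<exists>y\<in>Q \<times> UNIV. nrm (fst y) f > ennreal (1 / Suc (snd y)))"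
      using nrm_positive_iff[of _ f] by fastforce
    also have "\<dots> \<longleftrightarrow> (\<exists>k. nrm (fst (g k)) f > ennreal (1 / Suc (snd (g k))))"
      unfolding g[symmetric] by auto
    finally show ?thesis .
  qed
  then show thesis
    using gQ by (intro that[of "\<lambda>k. fst (g k)" "\<lambda>k. 1 / Suc (snd (g k))"
      "\<lambda>k. {f \<in> space D. nrm (fst (g k)) f > ennreal (1 / Suc (snd (g k)))}"]) auto
qed

lemma emeasure_sup_zero: "emeasure \<nu> {f \<in> space D. (SUP t\<in>Q. nrm t f) = 0} = 0"
  using tail by (simp add: tail_measure_def)

lemma sigma_finite_tail: "sigma_finite_measure \<nu>"
proof -
  obtain B q x where B: "\<And>k. q k \<in> Q" "\<And>k::nat. x k > (0::real)"
    "\<And>k. B k = {f \<in> space D. nrm (q k) f > ennreal (x k)}"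
    "{f \<in> space D. (SUP t\<in>Q. nrm t f) \<noteq> 0} = (\<Union>k. B k)"
    by (rule exhaustion) blast
  let ?N = "{f \<in> space D. (SUP t\<in>Q. nrm t f) = 0}"
  have Bs: "B k \<in> sets D" for k using B(1)[of k] unfolding B(3) by measurable
  have "?N = space D - (\<Union>k. B k)" unfolding B(4)[symmetric] by auto
  then have N: "?N \<in> sets D" using Bs by auto
  show ?thesis
  proof (standard, intro exI[of _ "insert ?N (range B)"] conjI ballI)
    show "\<Union> (insert ?N (range B)) = space \<nu>"
      using B(4) by auto
    fix a assume "a \<in> insert ?N (range B)"
    then show "emeasure \<nu> a \<noteq> \<infinity>"
    proof
      assume "a \<in> range B"
      then obtain k where "a = B k" by auto
      then show ?thesis
        using emeasure_nrm_greater[OF B(1,2), of k] weight_finite[OF B(1), of k]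
        by (auto simp: B(3) ennreal_mult_eq_top_iff)
    qed (use emeasure_sup_zero in simp)
  qed (use N Bs in auto)
qed

section \<open>The polar identity\<close>

text \<open>
  The mass of \<open>F\<close> along the orbit of \<open>f\<close>, beyond the point where the orbit leaves the unit ball of
  \<open>nrm t\<close>. It is homogeneous of order \<open>\<alpha>\<close> in \<open>f\<close>.
\<close>

abbreviation orbit_integral :: "'t \<Rightarrow> ('d \<Rightarrow> ennreal) \<Rightarrow> 'd \<Rightarrow> ennreal" where
  "orbit_integral t F f \<equiv>
     (\<integral>\<^sup>+s. power_density \<alpha> s * (of_bool (ennreal s * nrm t f > 1) * F (act s f)) \<partial>half_line)"

lemma pair_sigma_finite_half_line: "pair_sigma_finite half_line \<nu>"
  by (intro pair_sigma_finite.intro sigma_finite_half_line sigma_finite_tail)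

text \<open>
  The homogeneity of \<open>\<nu>\<close> is used once for each radius \<open>s\<close>: the substitution of \<open>act s f\<close> for \<open>f\<close> trades the
  condition \<open>nrm h f > 1\<close> for \<open>nrm h f > s\<close>, and integrating out \<open>s\<close> produces \<open>(nrm h f)\<^sup>\<alpha>\<close>, which
  cancels the weight \<open>(nrm h f)\<^sup>-\<^sup>\<alpha>\<close>.
\<close>

lemma polar_identity:
  assumes h [measurable]: "h \<in> Q" and t [measurable]: "t \<in> Q"
    and F [measurable]: "F \<in> borel_measurable D"
  shows "(\<integral>\<^sup>+f. of_bool (nrm h f > 1) * ennreal (rnrm h f powr (- \<alpha>)) *
      orbit_integral t F f \<partial>\<nu>)
    = (\<integral>\<^sup>+f. of_bool (nrm t f > 1 \<and> nrm h f > 0) * F f \<partial>\<nu>)" (is "?lhs = ?rhs")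
proof -
  interpret pair_sigma_finite half_line \<nu> by (rule pair_sigma_finite_half_line)
  have act_m [measurable]: "(\<lambda>x. act (fst x) (snd x)) \<in> half_line \<Otimes>\<^sub>M \<nu> \<rightarrow>\<^sub>M D"
    by (rule measurable_act_comp) (simp_all add: measurable_cong_sets[OF refl sets_half_line[symmetric]]
      measurable_cong_sets[OF refl sets_tail[symmetric]])
  have fst_m [measurable]: "fst \<in> borel_measurable (half_line \<Otimes>\<^sub>M \<nu>)"
    by (rule measurable_compose[OF measurable_fst]) (simp add: measurable_cong_sets[OF sets_half_line refl])
  define k where "k s f = of_bool (nrm h f > 1) * ennreal (rnrm h f powr (- \<alpha>)) *
      (power_density \<alpha> s * (of_bool (ennreal s * nrm t f > 1) * F (act s f)))" for s f
  define w where "w f = ennreal (rnrm h f powr (- \<alpha>)) * (of_bool (nrm t f > 1) * F f)" for f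
  have w [measurable]: "w \<in> borel_measurable D" unfolding w_def by measurable
  have k_m: "case_prod k \<in> borel_measurable (half_line \<Otimes>\<^sub>M \<nu>)"
    unfolding k_def case_prod_unfold by measurable
  \<comment> \<open>For fixed \<open>s\<close> the integrand is a function \<open>G\<close> of \<open>act s f\<close>; its scaling factor \<open>s\<^sup>\<alpha>\<close> and the one
    from \<open>(nrm h f)\<^sup>-\<^sup>\<alpha>\<close> turn the weight \<open>s\<^sup>-\<^sup>\<alpha>\<^sup>-\<^sup>1\<close> into \<open>s\<^sup>\<alpha>\<^sup>-\<^sup>1\<close>.\<close>
  have slice: "(\<integral>\<^sup>+f. k s f \<partial>\<nu>) = (\<integral>\<^sup>+f. ennreal (\<alpha> * s powr (\<alpha> - 1)) * of_bool (nrm h f > ennreal s) * w f \<partial>\<nu>)"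
    if "s \<in> space half_line" for s
  proof -
    from that have s: "s > 0" by (simp add: space_restrict_space)
    define G where "G f = power_density \<alpha> s * (of_bool (nrm h f > ennreal s) * ennreal (s powr \<alpha>) * w f)" for f
    have Gm: "G \<in> borel_measurable D" unfolding G_def by measurable
    have "k s f = G (act s f)" if f: "f \<in> space \<nu>" for f
    proof (cases "1 < nrm h f")
      case True
      have "ennreal s < ennreal s * nrm h f"
        using True s by (simp add: ennreal_less_mult_iff)
      moreover have "s powr \<alpha> * (s * rnrm h f) powr (- \<alpha>) = rnrm h f powr (- \<alpha>)"
        using s by (simp add: powr_mult powr_minus field_simps)
      then have "ennreal (rnrm h f powr (- \<alpha>)) = ennreal (s powr \<alpha>) * ennreal ((s * rnrm h f) powr (- \<alpha>))"
        by (simp flip: ennreal_mult)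
      ultimately show ?thesis
        using f s h t True by (simp add: k_def G_def w_def nrm_act enn2real_mult mult_ac)
    next
      case False
      have "\<not> ennreal s < ennreal s * nrm h f"
        using False s by (simp add: ennreal_less_mult_iff)
      with False f s h show ?thesis by (simp add: k_def G_def nrm_act)
    qed
    then have "(\<integral>\<^sup>+f. k s f \<partial>\<nu>) = (\<integral>\<^sup>+f. G (act s f) \<partial>\<nu>)" by (rule nn_integral_cong)
    also have "\<dots> = (\<integral>\<^sup>+f. ennreal (s powr \<alpha>) * G f \<partial>\<nu>)"
      unfolding nn_integral_act[OF s Gm] by (rule nn_integral_cmult[symmetric]) (use Gm in simp)
    also have "\<dots> = (\<integral>\<^sup>+f. ennreal (\<alpha> * s powr (\<alpha> - 1)) * of_bool (nrm h f > ennreal s) * w f \<partial>\<nu>)"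
    proof (rule nn_integral_cong)
      fix f
      have "s powr (\<alpha> - 1) = s powr \<alpha> * s powr (- \<alpha> - 1) * s powr \<alpha>"
        by (simp only: powr_add[symmetric]) simp
      then have "ennreal (\<alpha> * s powr (\<alpha> - 1)) = ennreal (s powr \<alpha>) * power_density \<alpha> s * ennreal (s powr \<alpha>)"
        using alpha_pos by (simp add: mult_ac flip: ennreal_mult)
      then show "ennreal (s powr \<alpha>) * G f = ennreal (\<alpha> * s powr (\<alpha> - 1)) * of_bool (nrm h f > ennreal s) * w f"
        by (simp add: G_def mult_ac)
    qed
    finally show ?thesis .
  qed
  have "?lhs = (\<integral>\<^sup>+f. \<integral>\<^sup>+s. k s f \<partial>half_line \<partial>\<nu>)"
  proof (rule nn_integral_cong)
    fix f assume f: "f \<in> space \<nu>"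
    have [measurable]: "(\<lambda>s. act s f) \<in> half_line \<rightarrow>\<^sub>M D"
      using f by (intro measurable_orbit) simp
    show "of_bool (nrm h f > 1) * ennreal (rnrm h f powr (- \<alpha>)) *
      orbit_integral t F f
      = (\<integral>\<^sup>+s. k s f \<partial>half_line)"
      unfolding k_def by (rule nn_integral_cmult[symmetric]) measurable
  qed
  also have "\<dots> = (\<integral>\<^sup>+s. \<integral>\<^sup>+f. k s f \<partial>\<nu> \<partial>half_line)"
    by (rule Fubini'[OF k_m])
  also have "\<dots> = (\<integral>\<^sup>+s. \<integral>\<^sup>+f. ennreal (\<alpha> * s powr (\<alpha> - 1)) * of_bool (nrm h f > ennreal s) * w f \<partial>\<nu> \<partial>half_line)"
    by (rule nn_integral_cong[OF slice])
  also have "\<dots> = (\<integral>\<^sup>+f. \<integral>\<^sup>+s. ennreal (\<alpha> * s powr (\<alpha> - 1)) * of_bool (nrm h f > ennreal s) * w f \<partial>half_line \<partial>\<nu>)"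
    by (rule Fubini'[symmetric]) (unfold case_prod_unfold, measurable)
  also have "\<dots> = ?rhs"
  proof (rule nn_integral_cong_AE, use nrm_finite_AE[OF h] in eventually_elim)
    fix f assume fin: "nrm h f < \<infinity>"
    have fin': "nrm h f = ennreal (rnrm h f)" using fin by simp
    have "(\<integral>\<^sup>+s. ennreal (\<alpha> * s powr (\<alpha> - 1)) * of_bool (nrm h f > ennreal s) * w f \<partial>half_line)
        = (\<integral>\<^sup>+s. ennreal (\<alpha> * s powr (\<alpha> - 1)) * of_bool (nrm h f > ennreal s) \<partial>half_line) * w f"
      by (rule nn_integral_multc) measurable
    also have "(\<integral>\<^sup>+s. ennreal (\<alpha> * s powr (\<alpha> - 1)) * of_bool (nrm h f > ennreal s) \<partial>half_line)
        = (\<integral>\<^sup>+s. ennreal (\<alpha> * s powr (\<alpha> - 1)) * of_bool (s < rnrm h f) \<partial>half_line)"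
      by (subst fin', intro nn_integral_cong) (auto simp: ennreal_less_iff space_restrict_space)
    also have "\<dots> = ennreal (rnrm h f powr \<alpha>)"
      by (rule nn_integral_power_below[OF alpha_pos]) simp
    also have "ennreal (rnrm h f powr \<alpha>) * w f = of_bool (nrm t f > 1 \<and> nrm h f > 0) * F f"
    proof (cases "nrm h f = 0")
      case False
      then have "rnrm h f > 0" using fin by (simp add: enn2real_positive_iff zero_less_iff_neq_zero)
      then have "ennreal (rnrm h f powr \<alpha>) * ennreal (rnrm h f powr (- \<alpha>)) = 1"
        by (simp flip: ennreal_mult powr_add)
      then show ?thesis using False
        by (simp add: w_def zero_less_iff_neq_zero mult.assoc[symmetric])
    qed simp
    finally show "(\<integral>\<^sup>+s. ennreal (\<alpha> * s powr (\<alpha> - 1)) * of_bool (nrm h f > ennreal s) * w f \<partial>half_line)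
      = of_bool (nrm t f > 1 \<and> nrm h f > 0) * F f" .
  qed
  finally show ?thesis .
qed

section \<open>Local tail processes\<close>

lemma AE_local_tail:
  assumes h: "h \<in> Q" and Y: "Y \<in> \<Omega> \<rightarrow>\<^sub>M D" and law: "distr \<Omega> D Y = local_tail_law nrm \<nu> h"
    and P: "AE f in \<nu>. 1 < nrm h f \<longrightarrow> P f"
  shows "AE \<omega> in \<Omega>. P (Y \<omega>)"
proof -
  have "AE f in local_tail_law nrm \<nu> h. P f"
    unfolding local_tail_law_def
  proof (rule AE_uniform_measureI)
    show "{f \<in> space \<nu>. 1 < nrm h f} \<in> sets \<nu>" using h by simp
    show "AE f in \<nu>. f \<in> {f \<in> space \<nu>. 1 < nrm h f} \<longrightarrow> P f"
      using P by eventually_elim simp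
  qed
  then show ?thesis
    unfolding law[symmetric] by (rule AE_distrD[OF Y])
qed

lemma nn_integral_local_tail:
  assumes h: "h \<in> Q" and p: "p h > 0" and Y: "Y \<in> \<Omega> \<rightarrow>\<^sub>M D" and law: "distr \<Omega> D Y = local_tail_law nrm \<nu> h"
    and G [measurable]: "G \<in> borel_measurable D"
  shows "p h * (\<integral>\<^sup>+\<omega>. G (Y \<omega>) \<partial>\<Omega>) = (\<integral>\<^sup>+f. of_bool (1 < nrm h f) * G f \<partial>\<nu>)"
proof -
  have "(\<integral>\<^sup>+\<omega>. G (Y \<omega>) \<partial>\<Omega>) = (\<integral>\<^sup>+f. G f \<partial>local_tail_law nrm \<nu> h)"
    unfolding law[symmetric] by (rule nn_integral_distr[symmetric]) (use Y in auto)
  also have "\<dots> = (\<integral>\<^sup>+f. G f * indicator {f \<in> space D. 1 < nrm h f} f \<partial>\<nu>) / p h"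
    unfolding local_tail_law_def weight_eq using h
    by (subst nn_integral_uniform_measure) simp_all
  also have "(\<integral>\<^sup>+f. G f * indicator {f \<in> space D. 1 < nrm h f} f \<partial>\<nu>) = (\<integral>\<^sup>+f. of_bool (1 < nrm h f) * G f \<partial>\<nu>)"
    by (intro nn_integral_cong) (auto split: split_indicator)
  finally show ?thesis
    using p weight_finite[OF h] by (simp add: ennreal_times_divide mult.commute[of "p h"] ennreal_mult_divide_eq)
qed

text \<open>
  The value \<open>1\<close> where the norm is \<open>0\<close> or \<open>\<infinity>\<close> keeps the radius positive, so that dividing by it is a measurable map of
  the whole space \<open>D\<close> into itself.
\<close>

definition radius :: "'t \<Rightarrow> 'd \<Rightarrow> real" where
  "radius h f = (if rnrm h f > 0 then rnrm h f else 1)"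

abbreviation angle :: "'t \<Rightarrow> 'd \<Rightarrow> 'd" where
  "angle h f \<equiv> act (inverse (radius h f)) f"

lemma radius_pos: "radius h f > 0"
  by (simp add: radius_def)

lemma radius_eq: "1 < nrm h f \<Longrightarrow> nrm h f < \<infinity> \<Longrightarrow> radius h f = rnrm h f"
  by (auto simp: radius_def enn2real_positive_iff intro: less_trans[OF zero_less_one])

lemma measurable_angle [measurable]:
  assumes [measurable]: "h \<in> Q"
  shows "angle h \<in> D \<rightarrow>\<^sub>M D"
proof (rule measurable_act_comp)
  have "(\<lambda>f. inverse (radius h f)) \<in> borel_measurable D"
    unfolding radius_def by measurable
  then show "(\<lambda>f. inverse (radius h f)) \<in> D \<rightarrow>\<^sub>M pos_borel"
    by (rule measurable_restrict_space2[rotated]) (simp add: radius_pos)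
qed simp

lemma AE_spectral:
  assumes h: "h \<in> Q" and p: "p h > 0" and Y: "local_processes D act nrm \<alpha> \<nu> \<Omega> h Y \<Theta>"
  shows "AE \<omega> in \<Omega>. 1 < nrm h (Y \<omega>) \<and> nrm h (Y \<omega>) < \<infinity> \<and> \<Theta> \<omega> = angle h (Y \<omega>)"
proof -
  have "AE \<omega> in \<Omega>. 1 < nrm h (Y \<omega>) \<and> nrm h (Y \<omega>) < \<infinity>"
  proof (rule AE_local_tail[OF h])
    show "AE f in \<nu>. 1 < nrm h f \<longrightarrow> 1 < nrm h f \<and> nrm h f < \<infinity>"
      using nrm_finite_AE[OF h] by eventually_elim simp
  qed (use Y p in \<open>auto simp: local_processes_def\<close>)
  moreover have "AE \<omega> in \<Omega>. \<omega> \<in> space \<Omega>" by simp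
  ultimately show ?thesis
  proof eventually_elim
    case (elim \<omega>)
    moreover from this have "0 < nrm h (Y \<omega>)" by (auto intro: less_trans[OF zero_less_one])
    ultimately show ?case
      using Y p radius_eq[of h "Y \<omega>"] by (auto simp: local_processes_def)
  qed
qed

lemma nn_integral_spectral:
  assumes h: "h \<in> Q" and p: "p h > 0" and Y: "local_processes D act nrm \<alpha> \<nu> \<Omega> h Y \<Theta>"
    and G [measurable]: "G \<in> borel_measurable D"
  shows "p h * (\<integral>\<^sup>+\<omega>. G (\<Theta> \<omega>) \<partial>\<Omega>) = (\<integral>\<^sup>+f. of_bool (1 < nrm h f) * G (angle h f) \<partial>\<nu>)"
proof -
  have "(\<integral>\<^sup>+\<omega>. G (\<Theta> \<omega>) \<partial>\<Omega>) = (\<integral>\<^sup>+\<omega>. G (angle h (Y \<omega>)) \<partial>\<Omega>)"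
    by (rule nn_integral_cong_AE, use AE_spectral[OF h p Y] in eventually_elim) simp
  moreover have "p h * (\<integral>\<^sup>+\<omega>. G (angle h (Y \<omega>)) \<partial>\<Omega>) = (\<integral>\<^sup>+f. of_bool (1 < nrm h f) * G (angle h f) \<partial>\<nu>)"
    by (rule nn_integral_local_tail[OF h p])
      (use Y p measurable_compose[OF measurable_angle[OF h] G] in \<open>auto simp: local_processes_def\<close>)
  ultimately show ?thesis by simp
qed

text \<open>
  If \<open>p h > 0\<close>, the norm of \<open>Y\<close> lies in \<open>(1, \<infinity>)\<close> almost surely and \<open>\<Theta>\<close> is the normalisation of \<open>Y\<close>. If
  \<open>p h = 0\<close>, the norm of \<open>Y\<close> is the Pareto variable itself, which exceeds \<open>1\<close> almost surely.
\<close>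

lemma local_norms_one:
  assumes "prob_space \<Omega>" and h: "h \<in> Q" and Y: "local_processes D act nrm \<alpha> \<nu> \<Omega> h Y \<Theta>"
  shows "measure \<Omega> {\<omega> \<in> space \<Omega>. 1 < nrm h (Y \<omega>)} = 1"
    and "measure \<Omega> {\<omega> \<in> space \<Omega>. nrm h (\<Theta> \<omega>) = 1} = 1"
proof -
  interpret prob_space \<Omega> by fact
  have Ym [measurable]: "Y \<in> \<Omega> \<rightarrow>\<^sub>M D" and Tm [measurable]: "\<Theta> \<in> \<Omega> \<rightarrow>\<^sub>M D"
    using Y by (auto simp: local_processes_def)
  have "measure \<Omega> {\<omega> \<in> space \<Omega>. 1 < nrm h (Y \<omega>)} = 1 \<and> measure \<Omega> {\<omega> \<in> space \<Omega>. nrm h (\<Theta> \<omega>) = 1} = 1"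
  proof (cases "p h > 0")
    case True
    have "AE \<omega> in \<Omega>. \<omega> \<in> space \<Omega>" by simp
    with AE_spectral[OF h True Y]
    have "AE \<omega> in \<Omega>. 1 < nrm h (Y \<omega>) \<and> nrm h (\<Theta> \<omega>) = 1"
    proof eventually_elim
      case (elim \<omega>)
      then have "Y \<omega> \<in> space D" using measurable_space[OF Ym] by auto
      moreover obtain r where "nrm h (Y \<omega>) = ennreal r" "r > 1"
        using elim by (cases "nrm h (Y \<omega>)") (auto simp flip: ennreal_1 simp: ennreal_less_iff)
      ultimately show ?case
        using elim h radius_eq[of h "Y \<omega>"] by (simp add: nrm_act radius_pos flip: ennreal_mult)
    qed
    then show ?thesis using h by (simp add: prob_Collect_eq_1)
  next
    case False
    then obtain R g where R: "pareto_rv \<Omega> \<alpha> R" and g: "g \<in> space D" "nrm h g = 1"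
      and eq: "\<And>\<omega>. \<omega> \<in> space \<Omega> \<Longrightarrow> Y \<omega> = act (R \<omega>) g \<and> \<Theta> \<omega> = g"
      using Y by (auto simp: local_processes_def)
    have "R \<omega> > 0" if "\<omega> \<in> space \<Omega>" for \<omega>
      using R measurable_space[of R \<Omega> pos_borel, OF _ that] by (auto simp: pareto_rv_def space_restrict_space)
    then have "{\<omega> \<in> space \<Omega>. 1 < nrm h (Y \<omega>)} = {\<omega> \<in> space \<Omega>. 1 < R \<omega>}"
      using eq g h by (auto simp: nrm_act)
    moreover have "{\<omega> \<in> space \<Omega>. nrm h (\<Theta> \<omega>) = 1} = space \<Omega>" using eq g by auto
    ultimately show ?thesis using R by (simp add: pareto_rv_def prob_space)
  qed
  then show "measure \<Omega> {\<omega> \<in> space \<Omega>. 1 < nrm h (Y \<omega>)} = 1"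
    "measure \<Omega> {\<omega> \<in> space \<Omega>. nrm h (\<Theta> \<omega>) = 1} = 1" by auto
qed

lemma local_norms_zero:
  assumes h: "h \<in> Q" and t: "t \<in> Q" and p: "p h = 0" "p t > 0"
    and Y: "local_processes D act nrm \<alpha> \<nu> \<Omega> t Y \<Theta>"
  shows "AE \<omega> in \<Omega>. nrm h (Y \<omega>) = 0 \<and> nrm h (\<Theta> \<omega>) = 0"
proof -
  have Ym: "Y \<in> \<Omega> \<rightarrow>\<^sub>M D" using Y by (auto simp: local_processes_def)
  have "AE \<omega> in \<Omega>. nrm h (Y \<omega>) = 0"
    by (rule AE_local_tail[OF t Ym])
      (use Y p nrm_zero_AE[OF h p(1)] in \<open>auto simp: local_processes_def\<close>)
  moreover have "AE \<omega> in \<Omega>. \<omega> \<in> space \<Omega>" by simp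
  ultimately show ?thesis
    using AE_spectral[OF t p(2) Y]
    by eventually_elim (use h measurable_space[OF Ym] in \<open>auto simp: nrm_act radius_pos\<close>)
qed

section \<open>Change of the reference coordinate\<close>

text \<open>
  The left side integrates \<open>G (act x f)\<close> over \<open>nrm h f > 1\<close> and \<open>nrm t (act x f) > 1\<close>. In terms of
  \<open>act x f\<close> these conditions read \<open>nrm h > x\<close> and \<open>nrm t > 1\<close>, and homogeneity contributes \<open>x\<^sup>\<alpha>\<close>.
\<close>

lemma tail_change:
  assumes h [measurable]: "h \<in> Q" and t [measurable]: "t \<in> Q" and p: "p h > 0" "p t > 0" and x: "x > 0"
    and Yh: "local_processes D act nrm \<alpha> \<nu> \<Omega> h Yh \<Theta>h"
    and Yt: "local_processes D act nrm \<alpha> \<nu> \<Omega> t Yt \<Theta>t"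
    and G [measurable]: "G \<in> borel_measurable D"
  shows "p h * (\<integral>\<^sup>+\<omega>. of_bool (ennreal x * nrm t (Yh \<omega>) > 1) * G (act x (Yh \<omega>)) \<partial>\<Omega>)
    = p t * ennreal (x powr \<alpha>) * (\<integral>\<^sup>+\<omega>. of_bool (nrm h (Yt \<omega>) > ennreal x) * G (Yt \<omega>) \<partial>\<Omega>)"
proof -
  let ?G = "\<lambda>f. of_bool (nrm h f > ennreal x) * (of_bool (nrm t f > 1) * G f)"
  have [measurable]: "act x \<in> D \<rightarrow>\<^sub>M D" by (rule measurable_act[OF x])
  have "p h * (\<integral>\<^sup>+\<omega>. of_bool (ennreal x * nrm t (Yh \<omega>) > 1) * G (act x (Yh \<omega>)) \<partial>\<Omega>)
      = (\<integral>\<^sup>+f. of_bool (1 < nrm h f) * (of_bool (ennreal x * nrm t f > 1) * G (act x f)) \<partial>\<nu>)"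
    by (rule nn_integral_local_tail[OF h p(1)]) (use Yh p in \<open>auto simp: local_processes_def\<close>)
  also have "\<dots> = (\<integral>\<^sup>+f. ?G (act x f) \<partial>\<nu>)"
    using h t x by (intro nn_integral_cong) (simp add: nrm_act ennreal_less_mult_iff)
  also have "\<dots> = ennreal (x powr \<alpha>) * (\<integral>\<^sup>+f. ?G f \<partial>\<nu>)"
    by (rule nn_integral_act[OF x]) measurable
  also have "(\<integral>\<^sup>+f. ?G f \<partial>\<nu>) = (\<integral>\<^sup>+f. of_bool (1 < nrm t f) * (of_bool (nrm h f > ennreal x) * G f) \<partial>\<nu>)"
    by (simp add: mult_ac)
  also have "\<dots> = p t * (\<integral>\<^sup>+\<omega>. of_bool (nrm h (Yt \<omega>) > ennreal x) * G (Yt \<omega>) \<partial>\<Omega>)"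
    by (rule nn_integral_local_tail[OF t p(2), symmetric]) (use Yt p in \<open>auto simp: local_processes_def\<close>)
  finally show ?thesis by (simp add: mult_ac)
qed

text \<open>
  For a scaling-invariant \<open>G\<close> the orbit integral is \<open>(nrm t f)\<^sup>\<alpha> G f\<close>, so that the left side of
  \<open>polar_identity\<close> integrates \<open>(nrm t f / nrm h f)\<^sup>\<alpha> G f\<close>, where the ratio is the value of \<open>nrm t\<close> at \<open>f\<close>
  normalised by \<open>nrm h\<close>.
\<close>

lemma spectral_change:
  assumes h [measurable]: "h \<in> Q" and t [measurable]: "t \<in> Q" and p: "p h > 0" "p t > 0"
    and Yh: "local_processes D act nrm \<alpha> \<nu> \<Omega> h Yh \<Theta>h"
    and Yt: "local_processes D act nrm \<alpha> \<nu> \<Omega> t Yt \<Theta>t"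
    and G [measurable]: "G \<in> borel_measurable D"
    and inv: "\<And>c f. c > 0 \<Longrightarrow> f \<in> space D \<Longrightarrow> G (act c f) = G f"
  shows "p h * (\<integral>\<^sup>+\<omega>. ennreal_powr (nrm t (\<Theta>h \<omega>)) \<alpha> * G (\<Theta>h \<omega>) \<partial>\<Omega>)
    = p t * (\<integral>\<^sup>+\<omega>. of_bool (nrm h (\<Theta>t \<omega>) \<noteq> 0) * G (\<Theta>t \<omega>) \<partial>\<Omega>)"
proof -
  have "p h * (\<integral>\<^sup>+\<omega>. ennreal_powr (nrm t (\<Theta>h \<omega>)) \<alpha> * G (\<Theta>h \<omega>) \<partial>\<Omega>)
      = (\<integral>\<^sup>+f. of_bool (1 < nrm h f) * (ennreal_powr (nrm t (angle h f)) \<alpha> * G (angle h f)) \<partial>\<nu>)"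
    by (rule nn_integral_spectral[OF h p(1) Yh]) measurable
  also have "\<dots> = (\<integral>\<^sup>+f. of_bool (nrm h f > 1) * ennreal (rnrm h f powr (- \<alpha>)) *
      orbit_integral t G f \<partial>\<nu>)"
  proof (rule nn_integral_cong_AE, use nrm_finite_AE[OF h] nrm_finite_AE[OF t] AE_space[of \<nu>] in eventually_elim)
    fix f assume fin: "nrm h f < \<infinity>" "nrm t f < \<infinity>" and f: "f \<in> space \<nu>"
    define v where "v = rnrm t f"
    have v: "nrm t f = ennreal v" "v \<ge> 0" using fin by (simp_all add: v_def)
    have "orbit_integral t G f
        = (\<integral>\<^sup>+s. power_density \<alpha> s * of_bool (ennreal s * nrm t f > 1) * G f \<partial>half_line)"
      using f inv by (intro nn_integral_cong) (simp add: space_restrict_space mult_ac)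
    also have "\<dots> = (\<integral>\<^sup>+s. power_density \<alpha> s * of_bool (ennreal s * nrm t f > 1) \<partial>half_line) * G f"
      by (rule nn_integral_multc) measurable
    also have "(\<integral>\<^sup>+s. power_density \<alpha> s * of_bool (ennreal s * nrm t f > 1) \<partial>half_line) = ennreal (v powr \<alpha>)"
    proof (cases "v = 0")
      case False
      with v have v0: "v > 0" by simp
      have "(\<integral>\<^sup>+s. power_density \<alpha> s * of_bool (ennreal s * nrm t f > 1) \<partial>half_line)
          = (\<integral>\<^sup>+s. power_density \<alpha> s * of_bool (s > inverse v) \<partial>half_line)"
        using v0 v by (intro nn_integral_cong)
          (auto simp: space_restrict_space ennreal_less_iff field_simps simp flip: ennreal_mult ennreal_1)
      also have "\<dots> = ennreal (inverse v powr (- \<alpha>))"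
        using v0 by (intro nn_integral_power_above alpha_pos) simp
      finally show ?thesis using v0 by (simp add: powr_minus inverse_powr)
    qed (simp add: v)
    finally have inner: "orbit_integral t G f
      = ennreal (v powr \<alpha>) * G f" .
    show "of_bool (1 < nrm h f) * (ennreal_powr (nrm t (angle h f)) \<alpha> * G (angle h f)) =
      of_bool (nrm h f > 1) * ennreal (rnrm h f powr (- \<alpha>)) *
      orbit_integral t G f"
    proof (cases "1 < nrm h f")
      case True
      let ?r = "rnrm h f"
      have r: "radius h f = ?r" using True fin by (simp add: radius_eq)
      have r0: "?r > 0" using radius_pos[of h f] r by simp
      have "nrm t (angle h f) = ennreal (inverse ?r * v)"
        using f t v r0 by (simp add: nrm_act r ennreal_mult)
      then have "ennreal_powr (nrm t (angle h f)) \<alpha> = ennreal (?r powr (- \<alpha>)) * ennreal (v powr \<alpha>)"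
        using r0 v by (simp add: ennreal_powr_def powr_mult powr_minus inverse_powr flip: ennreal_mult)
      then show ?thesis
        unfolding inner using True f inv r0 by (simp add: r mult_ac)
    qed simp
  qed
  also have "\<dots> = (\<integral>\<^sup>+f. of_bool (nrm t f > 1 \<and> nrm h f > 0) * G f \<partial>\<nu>)"
    by (rule polar_identity[OF h t G])
  also have "\<dots> = (\<integral>\<^sup>+f. of_bool (1 < nrm t f) * (of_bool (nrm h (angle t f) \<noteq> 0) * G (angle t f)) \<partial>\<nu>)"
    using h inv radius_pos[of t] by (intro nn_integral_cong)
      (simp add: nrm_act zero_less_iff_neq_zero[of "nrm h _"] ennreal_eq_0_iff not_le)
  also have "\<dots> = p t * (\<integral>\<^sup>+\<omega>. of_bool (nrm h (\<Theta>t \<omega>) \<noteq> 0) * G (\<Theta>t \<omega>) \<partial>\<Omega>)"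
    by (rule nn_integral_spectral[OF t p(2) Yt, symmetric]) measurable
  finally show ?thesis .
qed

section \<open>The Pareto decomposition and uniqueness\<close>

text \<open>
  The substitution \<open>r = s * nrm h f\<close>: the point at Pareto distance \<open>r\<close> on the ray of the normalised \<open>f\<close> is
  \<open>act s f\<close>. This is the bridge from the Pareto expectation to \<open>polar_identity\<close>.
\<close>

lemma pareto_integral_angle:
  assumes h: "h \<in> Q" and f: "f \<in> space D" and gt: "1 < nrm h f" and fin: "nrm h f < \<infinity>"
    and F [measurable]: "F \<in> borel_measurable D"
  shows "(\<integral>\<^sup>+r. power_density \<alpha> r * of_bool (r > 1) * F (act r (angle h f)) \<partial>half_line)
    = ennreal (rnrm h f powr (- \<alpha>)) *
      orbit_integral h F f"
    (is "?H = _")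
proof -
  let ?w = "rnrm h f"
  have w: "radius h f = ?w" using gt fin by (simp add: radius_eq)
  have w0: "?w > 0" using radius_pos[of h f] w by simp
  have nw: "nrm h f = ennreal ?w" using fin by simp
  have af: "angle h f \<in> space D" using f radius_pos by (intro act_closed) simp_all
  have "?H = ennreal ?w * (\<integral>\<^sup>+s. power_density \<alpha> (?w * s) * of_bool (?w * s > 1)
      * F (act (?w * s) (angle h f)) \<partial>half_line)"
    by (rule nn_integral_half_line_scale[OF _ w0])
      (use measurable_orbit[OF af] in \<open>simp add: measurable_cong_sets[OF sets_half_line[symmetric] refl]\<close>)
  also have "\<dots> = (\<integral>\<^sup>+s. ennreal ?w * (power_density \<alpha> (?w * s) * of_bool (?w * s > 1)
      * F (act (?w * s) (angle h f))) \<partial>half_line)"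
  proof (rule nn_integral_cmult[symmetric])
    have [measurable]: "(\<lambda>s. act (?w * s) (angle h f)) \<in> half_line \<rightarrow>\<^sub>M D"
    proof (rule measurable_act_comp)
      show "(*) ?w \<in> half_line \<rightarrow>\<^sub>M pos_borel"
        using w0 by (intro measurable_restrict_space2) (auto simp: space_restrict_space)
    qed (use af in simp)
    show "(\<lambda>s. power_density \<alpha> (?w * s) * of_bool (?w * s > 1)
      * F (act (?w * s) (angle h f))) \<in> borel_measurable half_line"
      by measurable
  qed
  also have "\<dots> = (\<integral>\<^sup>+s. ennreal (?w powr (- \<alpha>)) * (power_density \<alpha> s *
      (of_bool (ennreal s * nrm h f > 1) * F (act s f))) \<partial>half_line)"
  proof (rule nn_integral_cong)
    fix s assume "s \<in> space half_line"
    then have s: "s > 0" by (simp add: space_restrict_space)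
    have "?w * s * inverse ?w = s" using w0 by simp
    moreover have "act (?w * s * inverse ?w) f = act (?w * s) (angle h f)"
      using act_mult[of "?w * s" "inverse ?w" f] w0 s f unfolding w by simp
    ultimately have "act (?w * s) (angle h f) = act s f" by metis
    moreover have "?w * (?w * s) powr (- \<alpha> - 1) = ?w powr (- \<alpha>) * s powr (- \<alpha> - 1)"
      using w0 s by (simp add: powr_mult powr_diff field_simps)
    then have "ennreal ?w * power_density \<alpha> (?w * s) = ennreal (?w powr (- \<alpha>)) * power_density \<alpha> s"
      using alpha_pos w0 by (simp add: mult.left_commute flip: ennreal_mult)
    moreover have "ennreal s * nrm h f > 1 \<longleftrightarrow> ?w * s > 1"
      by (subst nw) (use s w0 in \<open>simp add: ennreal_less_iff mult.commute flip: ennreal_mult ennreal_1\<close>)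
    ultimately show "ennreal ?w * (power_density \<alpha> (?w * s) * of_bool (?w * s > 1)
      * F (act (?w * s) (angle h f)))
      = ennreal (?w powr (- \<alpha>)) * (power_density \<alpha> s * (of_bool (ennreal s * nrm h f > 1) * F (act s f)))"
      by (simp add: mult.assoc[symmetric])
  qed
  also have "\<dots> = ennreal (?w powr (- \<alpha>)) * orbit_integral h F f"
    by (rule nn_integral_cmult) (use measurable_orbit[OF f] in measurable)
  finally show ?thesis .
qed

text \<open>
  For \<open>p h > 0\<close>, conditioning on \<open>\<Theta>\<close> makes the right-hand law the Pareto average over the rays of the
  normalised points, and \<open>polar_identity\<close> with both coordinates equal to \<open>h\<close> collapses it to the law of
  \<open>Y\<close>. For \<open>p h = 0\<close>, both laws are the image of the Pareto law along the ray of one fixed point.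
\<close>

lemma local_tail_pareto:
  assumes "prob_space \<Omega>" and h [measurable]: "h \<in> Q"
    and Y: "local_processes D act nrm \<alpha> \<nu> \<Omega> h Y \<Theta>"
    and R: "pareto_rv \<Omega> \<alpha> R" and ind: "indep_rvs \<Omega> pos_borel R D \<Theta>"
  shows "distr \<Omega> D Y = distr \<Omega> D (\<lambda>\<omega>. act (R \<omega>) (\<Theta> \<omega>))"
proof -
  interpret prob_space \<Omega> by fact
  have Ym [measurable]: "Y \<in> \<Omega> \<rightarrow>\<^sub>M D" and Tm [measurable]: "\<Theta> \<in> \<Omega> \<rightarrow>\<^sub>M D"
    using Y by (auto simp: local_processes_def)
  have Rm [measurable]: "R \<in> \<Omega> \<rightarrow>\<^sub>M pos_borel"
    using R by (auto simp: pareto_rv_def)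
  have RT [measurable]: "(\<lambda>\<omega>. act (R \<omega>) (\<Theta> \<omega>)) \<in> \<Omega> \<rightarrow>\<^sub>M D"
    by (rule measurable_act_comp) measurable
  show ?thesis
  proof (cases "p h > 0")
    case False
    then obtain R' g where R': "pareto_rv \<Omega> \<alpha> R'" and g: "g \<in> space D"
      and eq: "\<And>\<omega>. \<omega> \<in> space \<Omega> \<Longrightarrow> Y \<omega> = act (R' \<omega>) g \<and> \<Theta> \<omega> = g"
      using Y by (auto simp: local_processes_def)
    have a: "(\<lambda>r. act r g) \<in> pos_borel \<rightarrow>\<^sub>M D"
      by (rule measurable_act_comp) (use g in simp_all)
    have push: "distr \<Omega> D (\<lambda>\<omega>. act (S \<omega>) g) = distr (distr \<Omega> pos_borel S) D (\<lambda>r. act r g)"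
      if "pareto_rv \<Omega> \<alpha> S" for S
      using that by (subst distr_distr[OF a]) (auto simp: pareto_rv_def comp_def)
    have "distr \<Omega> D Y = distr \<Omega> D (\<lambda>\<omega>. act (R' \<omega>) g)"
      using eq by (intro distr_cong) auto
    also have "\<dots> = distr \<Omega> D (\<lambda>\<omega>. act (R \<omega>) g)"
      unfolding push[OF R] push[OF R'] distr_pareto[OF R alpha_pos] distr_pareto[OF R' alpha_pos] ..
    also have "\<dots> = distr \<Omega> D (\<lambda>\<omega>. act (R \<omega>) (\<Theta> \<omega>))"
      using eq by (intro distr_cong) auto
    finally show ?thesis .
  next
    case True
    let ?P = "density half_line (\<lambda>r. power_density \<alpha> r * of_bool (r > 1))"
    interpret P: prob_space ?P
      unfolding distr_pareto[OF R alpha_pos, symmetric] by (rule prob_space_distr) fact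
    interpret T: prob_space "distr \<Omega> D \<Theta>" by (rule prob_space_distr) fact
    interpret PT: pair_sigma_finite ?P "distr \<Omega> D \<Theta>" ..
    have act_m [measurable]: "(\<lambda>x. act (fst x) (snd x)) \<in> pos_borel \<Otimes>\<^sub>M D \<rightarrow>\<^sub>M D"
      by (rule measurable_act_comp) simp_all
    note measurable_orbit [measurable]
    have joint: "distr \<Omega> (pos_borel \<Otimes>\<^sub>M D) (\<lambda>\<omega>. (R \<omega>, \<Theta> \<omega>)) = ?P \<Otimes>\<^sub>M distr \<Omega> D \<Theta>"
      using distr_pair_indep_rvs[OF ind] distr_pareto[OF R alpha_pos] by simp
    show ?thesis
    proof (rule measure_eqI)
      fix A assume "A \<in> sets (distr \<Omega> D Y)"
      then have A [measurable]: "A \<in> sets D" by simp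
      define F :: "'d \<Rightarrow> ennreal" where "F = indicator A"
      have F [measurable]: "F \<in> borel_measurable D" unfolding F_def by measurable
      define H where "H f = (\<integral>\<^sup>+r. power_density \<alpha> r * of_bool (r > 1) * F (act r f) \<partial>half_line)" for f
      have sets_P: "sets (?P \<Otimes>\<^sub>M distr \<Omega> D \<Theta>) = sets (pos_borel \<Otimes>\<^sub>M D)"
        by (rule sets_pair_measure_cong) (simp_all add: sets_half_line)
      have H: "H \<in> borel_measurable D"
        unfolding H_def
      proof (rule sigma_finite_measure.borel_measurable_nn_integral[OF sigma_finite_half_line])
        have [measurable]: "(\<lambda>x. act (snd x) (fst x)) \<in> D \<Otimes>\<^sub>M half_line \<rightarrow>\<^sub>M D"
          by (rule measurable_act_comp) (simp_all add: measurable_cong_sets[OF refl sets_half_line[symmetric]])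
        show "(\<lambda>(f, r). power_density \<alpha> r * of_bool (r > 1) * F (act r f)) \<in> borel_measurable (D \<Otimes>\<^sub>M half_line)"
          unfolding case_prod_unfold by measurable
      qed
      have "emeasure (distr \<Omega> D (\<lambda>\<omega>. act (R \<omega>) (\<Theta> \<omega>))) A
          = (\<integral>\<^sup>+f. F f \<partial>distr \<Omega> D (\<lambda>\<omega>. act (R \<omega>) (\<Theta> \<omega>)))"
        by (simp add: F_def)
      also have "\<dots> = (\<integral>\<^sup>+\<omega>. F (act (R \<omega>) (\<Theta> \<omega>)) \<partial>\<Omega>)"
        by (rule nn_integral_distr) simp_all
      also have "\<dots> = (\<integral>\<^sup>+x. F (act (fst x) (snd x)) \<partial>distr \<Omega> (pos_borel \<Otimes>\<^sub>M D) (\<lambda>\<omega>. (R \<omega>, \<Theta> \<omega>)))"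
        by (subst nn_integral_distr) simp_all
      also have "\<dots> = (\<integral>\<^sup>+f. \<integral>\<^sup>+r. F (act r f) \<partial>?P \<partial>distr \<Omega> D \<Theta>)"
        unfolding joint by (subst PT.nn_integral_snd[symmetric])
          (simp_all add: measurable_cong_sets[OF sets_P refl])
      also have "\<dots> = (\<integral>\<^sup>+f. H f \<partial>distr \<Omega> D \<Theta>)"
        unfolding H_def by (intro nn_integral_cong nn_integral_density) simp_all
      also have "\<dots> = (\<integral>\<^sup>+\<omega>. H (\<Theta> \<omega>) \<partial>\<Omega>)"
        by (rule nn_integral_distr) (use H in simp_all)
      finally have "p h * emeasure (distr \<Omega> D (\<lambda>\<omega>. act (R \<omega>) (\<Theta> \<omega>))) A = p h * (\<integral>\<^sup>+\<omega>. H (\<Theta> \<omega>) \<partial>\<Omega>)"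
        by simp
      also have "\<dots> = (\<integral>\<^sup>+f. of_bool (1 < nrm h f) * H (angle h f) \<partial>\<nu>)"
        by (rule nn_integral_spectral[OF h True Y H])
      also have "\<dots> = (\<integral>\<^sup>+f. of_bool (nrm h f > 1) * ennreal (rnrm h f powr (- \<alpha>)) *
        orbit_integral h F f \<partial>\<nu>)"
      proof (rule nn_integral_cong_AE, use nrm_finite_AE[OF h] AE_space[of \<nu>] in eventually_elim)
        fix f assume fin: "nrm h f < \<infinity>" and "f \<in> space \<nu>"
        then have f: "f \<in> space D" by simp
        let ?w = "rnrm h f"
        show "of_bool (1 < nrm h f) * H (angle h f) = of_bool (nrm h f > 1) * ennreal (?w powr (- \<alpha>)) *
          orbit_integral h F f"
        proof (cases "1 < nrm h f")
          case True
          show ?thesis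
            using pareto_integral_angle[OF h f True fin F] True by (simp add: H_def)
        qed simp
      qed
      also have "\<dots> = (\<integral>\<^sup>+f. of_bool (nrm h f > 1 \<and> nrm h f > 0) * F f \<partial>\<nu>)"
        by (rule polar_identity[OF h h F])
      also have "\<dots> = (\<integral>\<^sup>+f. of_bool (1 < nrm h f) * F f \<partial>\<nu>)"
        by (intro nn_integral_cong) (auto intro: less_trans[OF zero_less_one])
      also have "\<dots> = p h * (\<integral>\<^sup>+\<omega>. F (Y \<omega>) \<partial>\<Omega>)"
        by (rule nn_integral_local_tail[OF h True, symmetric]) (use Y True in \<open>auto simp: local_processes_def\<close>)
      also have "(\<integral>\<^sup>+\<omega>. F (Y \<omega>) \<partial>\<Omega>) = emeasure (distr \<Omega> D Y) A"
        by (subst nn_integral_distr[OF Ym, symmetric]) (simp_all add: F_def)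
      finally show "emeasure (distr \<Omega> D Y) A = emeasure (distr \<Omega> D (\<lambda>\<omega>. act (R \<omega>) (\<Theta> \<omega>))) A"
        using ennreal_cancel_left[OF True weight_finite[OF h]] by simp
    qed simp
  qed
qed

text \<open>
  The indices coincide because the mass of one superlevel set at height \<open>2\<close> is \<open>2\<^sup>-\<^sup>\<alpha>\<close> times a positive finite
  weight. Homogeneity then carries the agreement from height \<open>1\<close> to all heights, and \<open>exhaustion\<close> carries it
  to the whole space.
\<close>

lemma tail_measure_unique:
  assumes tail': "tail_measure D act Q nrm \<beta> \<nu>'"
    and weights: "\<And>h. h \<in> Q \<Longrightarrow> tail_weight nrm \<nu>' h = p h"
    and laws: "\<And>h. h \<in> Q \<Longrightarrow> p h > 0 \<Longrightarrow> local_tail_law nrm \<nu> h = local_tail_law nrm \<nu>' h"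
  shows "\<nu>' = \<nu>"
proof -
  interpret N: tail_measure_setting D act Q nrm \<beta> \<nu>'
    by unfold_locales (rule tail')
  have level1: "emeasure \<nu>' ({f \<in> space D. nrm h f > 1} \<inter> A)
      = emeasure \<nu> ({f \<in> space D. nrm h f > 1} \<inter> A)"
    if h: "h \<in> Q" and A: "A \<in> sets D" for h A
  proof (cases "p h > 0")
    case True
    have "emeasure (local_tail_law nrm \<nu>' h) A = emeasure (local_tail_law nrm \<nu> h) A"
      using laws[OF h True] by simp
    then have "emeasure \<nu>' ({f \<in> space D. nrm h f > 1} \<inter> A) / p h
      = emeasure \<nu> ({f \<in> space D. nrm h f > 1} \<inter> A) / p h"
      using h A weights[OF h] unfolding local_tail_law_def by (simp add: weight_eq N.weight_eq)
    then have "emeasure \<nu>' ({f \<in> space D. nrm h f > 1} \<inter> A) / p h * p h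
      = emeasure \<nu> ({f \<in> space D. nrm h f > 1} \<inter> A) / p h * p h"
      by simp
    then show ?thesis
      using True weight_finite[OF h] by (simp add: ennreal_divide_times ennreal_mult_divide_eq)
  next
    case False
    then have "p h = 0" "N.p h = 0" using weights[OF h] by auto
    moreover have "emeasure \<nu> ({f \<in> space D. nrm h f > 1} \<inter> A) \<le> p h"
      unfolding weight_eq using h by (intro emeasure_mono) auto
    moreover have "emeasure \<nu>' ({f \<in> space D. nrm h f > 1} \<inter> A) \<le> N.p h"
      unfolding N.weight_eq using h by (intro emeasure_mono) auto
    ultimately show ?thesis by simp
  qed
  obtain h0 where h0: "h0 \<in> Q" "0 < p h0"
    using tail by (auto simp: tail_measure_def)
  have sub: "{f \<in> space D. nrm h0 f > 1} \<inter> {f \<in> space D. nrm h0 f > ennreal 2} = {f \<in> space D. nrm h0 f > ennreal 2}"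
    by (auto intro: less_trans[of 1 "2::ennreal"])
  \<comment> \<open>The set at height \<open>2\<close> lies inside the one at height \<open>1\<close>, where the two measures already agree.\<close>
  have "ennreal (2 powr (- \<beta>)) * p h0 = ennreal (2 powr (- \<alpha>)) * p h0"
    using level1[OF h0(1), of "{f \<in> space D. nrm h0 f > ennreal 2}", unfolded sub] h0(1)
      emeasure_nrm_greater[OF h0(1), of 2] N.emeasure_nrm_greater[OF h0(1), of 2] weights[OF h0(1)]
    by simp
  then have "ennreal (2 powr (- \<beta>)) = ennreal (2 powr (- \<alpha>))"
    using ennreal_cancel_left[OF h0(2) weight_finite[OF h0(1)]] by (simp add: mult.commute)
  then have ab: "\<beta> = \<alpha>" by (simp add: powr_inj)
  have level: "emeasure \<nu>' ({f \<in> space D. nrm h f > ennreal x} \<inter> A)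
      = emeasure \<nu> ({f \<in> space D. nrm h f > ennreal x} \<inter> A)"
    if h: "h \<in> Q" and x: "x > 0" and A: "A \<in> sets D" for h x A
  proof -
    let ?B = "{f \<in> space D. nrm h f > ennreal x} \<inter> A"
    let ?A' = "act x -` A \<inter> space D"
    have B: "?B \<in> sets D" using h A by simp
    have A': "?A' \<in> sets D" using measurable_act[OF x] A by (rule measurable_sets)
    have ind: "indicator ?B (act x f) = (indicator ({f \<in> space D. nrm h f > 1} \<inter> ?A') f :: ennreal)"
      if "f \<in> space D" for f
      using that h x act_closed[OF x that] by (auto simp: nrm_act ennreal_less_mult_iff split: split_indicator)
    have "ennreal (x powr \<alpha>) * emeasure \<nu> ?B = (\<integral>\<^sup>+f. indicator ?B (act x f) \<partial>\<nu>)"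
      using nn_integral_act[OF x, of "indicator ?B"] B by simp
    also have "\<dots> = (\<integral>\<^sup>+f. indicator ({f \<in> space D. nrm h f > 1} \<inter> ?A') f \<partial>\<nu>)"
      by (rule nn_integral_cong) (simp add: ind)
    also have "\<dots> = emeasure \<nu> ({f \<in> space D. nrm h f > 1} \<inter> ?A')"
      using A' h by simp
    also have "\<dots> = emeasure \<nu>' ({f \<in> space D. nrm h f > 1} \<inter> ?A')"
      by (rule level1[OF h A', symmetric])
    also have "\<dots> = (\<integral>\<^sup>+f. indicator ({f \<in> space D. nrm h f > 1} \<inter> ?A') f \<partial>\<nu>')"
      using A' h by simp
    also have "\<dots> = (\<integral>\<^sup>+f. indicator ?B (act x f) \<partial>\<nu>')"
      by (rule nn_integral_cong) (simp add: ind)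
    also have "\<dots> = ennreal (x powr \<alpha>) * emeasure \<nu>' ?B"
      using N.nn_integral_act[OF x, of "indicator ?B"] B ab by simp
    finally show ?thesis
      using ennreal_cancel_left[of "ennreal (x powr \<alpha>)"] x by simp
  qed
  obtain B q x where B: "\<And>k. q k \<in> Q" "\<And>k::nat. x k > (0::real)"
    "\<And>k. B k = {f \<in> space D. nrm (q k) f > ennreal (x k)}"
    "{f \<in> space D. (SUP t\<in>Q. nrm t f) \<noteq> 0} = (\<Union>k. B k)"
    by (rule exhaustion) blast
  \<comment> \<open>Each disjoint piece still lies in one superlevel set, so the two measures agree on its subsets.\<close>
  let ?C = "disjointed B"
  have Bs: "B k \<in> sets D" for k using B(1)[of k] unfolding B(3) by measurable
  then have Cs: "?C k \<in> sets D" for k by (metis range_subsetD image_subset_iff sets.range_disjointed_sets)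
  let ?N = "{f \<in> space D. (SUP t\<in>Q. nrm t f) = 0}"
  have N: "?N = space D - (\<Union>k. B k)" unfolding B(4)[symmetric] by auto
  then have Ns: "?N \<in> sets D" using Bs by auto
  have decomp: "emeasure M A = (\<Sum>k. emeasure M (?C k \<inter> A))"
    if M: "sets M = sets D" and null: "emeasure M ?N = 0" and A: "A \<in> sets D" for M A
  proof -
    have "A = (\<Union>k. ?C k \<inter> A) \<union> (A \<inter> ?N)"
      using sets.sets_into_space[OF A] by (auto simp: N UN_disjointed_eq[of B, symmetric] simp del: UN_disjointed_eq)
    then have "emeasure M A = emeasure M ((\<Union>k. ?C k \<inter> A) \<union> (A \<inter> ?N))" by simp
    also have "\<dots> = emeasure M (\<Union>k. ?C k \<inter> A)"
    proof (rule emeasure_Un_null_set)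
      show "A \<inter> ?N \<in> null_sets M"
        using null A Ns M null_set_Int1[of ?N M A] by (auto simp: null_sets_def Int_commute)
    qed (use Cs A M in auto)
    also have "\<dots> = (\<Sum>k. emeasure M (?C k \<inter> A))"
    proof (rule suminf_emeasure[symmetric])
      show "disjoint_family (\<lambda>k. ?C k \<inter> A)"
        using disjoint_family_disjointed[of B] by (auto simp: disjoint_family_on_def)
    qed (use Cs A M in auto)
    finally show ?thesis .
  qed
  show ?thesis
  proof (rule measure_eqI)
    fix A assume "A \<in> sets \<nu>'"
    then have A: "A \<in> sets D" by simp
    have "emeasure \<nu>' (?C k \<inter> A) = emeasure \<nu> (?C k \<inter> A)" for k
    proof -
      have "?C k \<inter> A = {f \<in> space D. nrm (q k) f > ennreal (x k)} \<inter> (?C k \<inter> A)"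
        using disjointed_subset[of B k] by (auto simp: B(3))
      then show ?thesis
        using level[OF B(1) B(2), of "?C k \<inter> A" k k] Cs A by auto
    qed
    then show "emeasure \<nu>' A = emeasure \<nu> A"
      using decomp[OF sets_tail emeasure_sup_zero A] decomp[OF N.sets_tail N.emeasure_sup_zero A] by simp
  qed simp
qed

end

lemma class_H_measurable: "\<Gamma> \<in> class_H D \<Longrightarrow> \<Gamma> \<in> borel_measurable D"
  by (auto simp: class_H_def)

theorem proposition3p6:
  fixes D \<nu> :: "'d measure"
    and act :: "real \<Rightarrow> 'd \<Rightarrow> 'd"
    and Q :: "'t set"
    and nrm :: "'t \<Rightarrow> 'd \<Rightarrow> ennreal"
    and \<alpha> :: real
    and p :: "'t \<Rightarrow> ennreal"
    and \<Omega> :: "'w measure"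
    and Y \<Theta> :: "'t \<Rightarrow> 'w \<Rightarrow> 'd"
  assumes setting: "tail_setting D act Q nrm"
    and tail: "tail_measure D act Q nrm \<alpha> \<nu>"
    and p: "p = tail_weight nrm \<nu>"
    and prob: "prob_space \<Omega>"
    and processes: "\<And>h. h \<in> Q \<Longrightarrow> local_processes D act nrm \<alpha> \<nu> \<Omega> h (Y h) (\<Theta> h)"
  shows
    "((\<forall>h\<in>Q. measure \<Omega> {\<omega> \<in> space \<Omega>. nrm h (Y h \<omega>) > 1} = 1 \<and>
            measure \<Omega> {\<omega> \<in> space \<Omega>. nrm h (\<Theta> h \<omega>) = 1} = 1) \<and>
     (\<forall>h\<in>Q. \<forall>t\<in>Q. p h = 0 \<and> p t > 0 \<longrightarrow>
        (AE \<omega> in \<Omega>. nrm h (Y t \<omega>) = 0 \<and> nrm h (\<Theta> t \<omega>) = 0))) \<and>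
     (\<forall>h\<in>Q. \<forall>t\<in>Q. p h * p t > 0 \<longrightarrow>
       (\<forall>\<Gamma>\<in>class_H0 D act.
          let X = (\<lambda>\<omega>. enn2ereal (ennreal_powr (nrm t (\<Theta> h \<omega>)) \<alpha>) * \<Gamma> (\<Theta> h \<omega>));
              Z = (\<lambda>\<omega>. of_bool (nrm h (\<Theta> t \<omega>) \<noteq> 0) * \<Gamma> (\<Theta> t \<omega>))
          in (expect_exists \<Omega> X \<longleftrightarrow> expect_exists \<Omega> Z) \<and>
             (expect_exists \<Omega> X \<longrightarrow>
                enn2ereal (p h) * expect \<Omega> X = enn2ereal (p t) * expect \<Omega> Z)) \<and>
       (\<forall>x>0. \<forall>\<Gamma>\<in>class_H D.
          let X = (\<lambda>\<omega>. \<Gamma> (act x (Y h \<omega>)) * of_bool (ennreal x * nrm t (Y h \<omega>) > 1));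
              Z = (\<lambda>\<omega>. \<Gamma> (Y t \<omega>) * of_bool (nrm h (Y t \<omega>) > ennreal x))
          in (expect_exists \<Omega> X \<longleftrightarrow> expect_exists \<Omega> Z) \<and>
             (expect_exists \<Omega> X \<longrightarrow>
                enn2ereal (p h) * expect \<Omega> X = enn2ereal (p t) * ereal (x powr \<alpha>) * expect \<Omega> Z))) \<and>
     ((\<forall>h\<in>Q. \<forall>R. pareto_rv \<Omega> \<alpha> R \<and> indep_rvs \<Omega> pos_borel R D (\<Theta> h) \<longrightarrow>
        distr \<Omega> D (Y h) = distr \<Omega> D (\<lambda>\<omega>. act (R \<omega>) (\<Theta> h \<omega>))) \<and>
     (\<forall>\<beta> \<nu>'. tail_measure D act Q nrm \<beta> \<nu>' \<and>
        (\<forall>h\<in>Q. tail_weight nrm \<nu>' h = p h) \<and>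
        (\<forall>h\<in>Q. p h > 0 \<longrightarrow> distr \<Omega> D (Y h) = local_tail_law nrm \<nu>' h) \<longrightarrow>
        \<nu>' = \<nu>))"
proof -
  interpret tail_measure_setting D act Q nrm \<alpha> \<nu>
    by (intro tail_measure_setting.intro setting tail_measure_setting_axioms.intro tail)
  note [simp] = p
  have spectral: "expect_exists \<Omega> X = expect_exists \<Omega> Z \<and>
      enn2ereal (p h) * expect \<Omega> X = enn2ereal (p t) * expect \<Omega> Z"
    if ht: "h \<in> Q" "t \<in> Q" "p h > 0" "p t > 0" and \<Gamma>: "\<Gamma> \<in> class_H0 D act"
      and X: "X = (\<lambda>\<omega>. enn2ereal (ennreal_powr (nrm t (\<Theta> h \<omega>)) \<alpha>) * \<Gamma> (\<Theta> h \<omega>))"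
      and Z: "Z = (\<lambda>\<omega>. of_bool (nrm h (\<Theta> t \<omega>) \<noteq> 0) * \<Gamma> (\<Theta> t \<omega>))"
    for h t \<Gamma> X Z
  proof -
    have [measurable]: "\<Gamma> \<in> borel_measurable D" and inv: "\<And>c f. c > 0 \<Longrightarrow> f \<in> space D \<Longrightarrow> \<Gamma> (act c f) = \<Gamma> f"
      using \<Gamma> by (auto simp: class_H0_def class_H_measurable)
    have ht': "tail_weight nrm \<nu> h > 0" "tail_weight nrm \<nu> t > 0" using ht by simp_all
    note change = spectral_change[OF ht(1,2) ht' processes[OF ht(1)] processes[OF ht(2)]]
    have pos: "p h * (\<integral>\<^sup>+\<omega>. e2ennreal (X \<omega>) \<partial>\<Omega>) = p t * (\<integral>\<^sup>+\<omega>. e2ennreal (Z \<omega>) \<partial>\<Omega>)"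
      using change[of "\<lambda>f. e2ennreal (\<Gamma> f)"] inv
      by (simp add: X Z e2ennreal_mult_enn2ereal of_bool_enn2ereal)
    have neg: "p h * (\<integral>\<^sup>+\<omega>. e2ennreal (- X \<omega>) \<partial>\<Omega>) = p t * (\<integral>\<^sup>+\<omega>. e2ennreal (- Z \<omega>) \<partial>\<Omega>)"
      using change[of "\<lambda>f. e2ennreal (- \<Gamma> f)"] inv
      by (simp add: X Z e2ennreal_mult_enn2ereal of_bool_enn2ereal flip: ereal_mult_minus_right)
    show ?thesis
      using expect_transfer[OF ht(3) _ ht(4) _ pos neg] weight_finite ht by simp
  qed
  have shifted: "expect_exists \<Omega> X = expect_exists \<Omega> Z \<and>
      enn2ereal (p h) * expect \<Omega> X = enn2ereal (p t) * ereal (x powr \<alpha>) * expect \<Omega> Z"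
    if ht: "h \<in> Q" "t \<in> Q" "p h > 0" "p t > 0" and x: "x > 0" and \<Gamma>: "\<Gamma> \<in> class_H D"
      and X: "X = (\<lambda>\<omega>. \<Gamma> (act x (Y h \<omega>)) * of_bool (ennreal x * nrm t (Y h \<omega>) > 1))"
      and Z: "Z = (\<lambda>\<omega>. \<Gamma> (Y t \<omega>) * of_bool (nrm h (Y t \<omega>) > ennreal x))"
    for h t x \<Gamma> X Z
  proof -
    have [measurable]: "\<Gamma> \<in> borel_measurable D" using \<Gamma> by (rule class_H_measurable)
    have ht': "tail_weight nrm \<nu> h > 0" "tail_weight nrm \<nu> t > 0" using ht by simp_all
    note change = tail_change[OF ht(1,2) ht' x processes[OF ht(1)] processes[OF ht(2)]]
    have pos: "p h * (\<integral>\<^sup>+\<omega>. e2ennreal (X \<omega>) \<partial>\<Omega>) = p t * ennreal (x powr \<alpha>) * (\<integral>\<^sup>+\<omega>. e2ennreal (Z \<omega>) \<partial>\<Omega>)"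
      using change[of "\<lambda>f. e2ennreal (\<Gamma> f)"]
      by (simp add: X Z mult.commute[of "\<Gamma> _"] e2ennreal_mult_enn2ereal of_bool_enn2ereal)
    have neg: "p h * (\<integral>\<^sup>+\<omega>. e2ennreal (- X \<omega>) \<partial>\<Omega>) = p t * ennreal (x powr \<alpha>) * (\<integral>\<^sup>+\<omega>. e2ennreal (- Z \<omega>) \<partial>\<Omega>)"
      using change[of "\<lambda>f. e2ennreal (- \<Gamma> f)"]
      by (simp add: X Z mult.commute[of "\<Gamma> _"] e2ennreal_mult_enn2ereal of_bool_enn2ereal flip: ereal_mult_minus_right)
    have "0 < p t * ennreal (x powr \<alpha>)" "p t * ennreal (x powr \<alpha>) < \<infinity>"
      using ht x weight_finite[OF ht(2)] by (auto simp: ennreal_zero_less_mult_iff ennreal_mult_less_top)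
    note expect_transfer[OF ht(3) _ this pos neg]
    then show ?thesis
      using weight_finite ht by (simp add: times_ennreal.rep_eq enn2ereal_ennreal)
  qed
  have positive: "p h > 0 \<and> p t > 0" if "p h * p t > 0" for h t
    using that by (simp add: ennreal_zero_less_mult_iff)
  have unique: "\<nu>' = \<nu>"
    if "tail_measure D act Q nrm \<beta> \<nu>'" "\<forall>h\<in>Q. tail_weight nrm \<nu>' h = p h"
      "\<forall>h\<in>Q. p h > 0 \<longrightarrow> distr \<Omega> D (Y h) = local_tail_law nrm \<nu>' h" for \<beta> \<nu>'
  proof (rule tail_measure_unique[OF that(1)])
    show "local_tail_law nrm \<nu> h = local_tail_law nrm \<nu>' h" if "h \<in> Q" "tail_weight nrm \<nu> h > 0" for h
      using processes[OF that(1)] that \<open>\<forall>h\<in>Q. p h > 0 \<longrightarrow> distr \<Omega> D (Y h) = local_tail_law nrm \<nu>' h\<close>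
      by (auto simp: local_processes_def)
  qed (use that in simp)
  show ?thesis
    unfolding Let_def
    apply (intro conjI ballI allI impI)
    subgoal by (rule local_norms_one(1)[OF prob _ processes])
    subgoal by (rule local_norms_one(2)[OF prob _ processes])
    subgoal using local_norms_zero[OF _ _ _ _ processes] by simp
    subgoal using positive spectral by blast
    subgoal using positive spectral by blast
    subgoal using positive shifted by blast
    subgoal using positive shifted by blast
    subgoal using local_tail_pareto[OF prob _ processes] by blast
    subgoal using unique by blast
    done
qed

end
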